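(* Let $\mathcal{G}=(A\,\dot\cup\,B,G)$ be a definable, $\lambda$-preserving, bipartite graph with $A,B\subseteq\mathbb{R}^n$ bounded definable sets, let $M\subseteq G$ be a definable matching, and let $K\ge 0$ be an integer. Let $\mathcal{P}$ be a set of paths of length $\le 2K+1$ in $\mathcal{G}$, with its measure $\nu$, constructed from $\mathcal{G}$, $M$ and $K$ as described in the context. Let $\delta\in\mathbb{R}^{>0}$. Then there is a definable matching $M'\subseteq G$ covering the vertices covered by $M$, and not having any augmenting paths of length $\le 2K+1$ in $\mathcal{P}$ outside of a definable subset of $\mathcal{P}$ of $\nu$-measure $<\delta$.
   Context: $R$ is an o-minimal expansion of the ordered field of real numbers (underlying set $\mathbb{R}$); "definable" means definable in $R$ (with parameters), and $n\ge1$. $\lambda$ is $n$-dimensional Lebesgue measure. Graphs: a graph $(V,E)$ has a nonempty vertex set $V$ and a symmetric, antireflexive edge relation $E\subseteq V^2$. It is definable if $V\subseteq\mathbb{R}^n$ and $E\subseteq\mathbb{R}^{2n}$ are definable. A definable bipartite graph $(A\,\dot\cup\,B,E)$ is a definable graph whose vertex set is partitioned into disjoint definable sets $A,B$ such that each edge has one vertex in $A$ and the other in $B$. A matching is a set of edges that is the graph of a bijection between a subset of $A$ and a subset of $B$; it covers the vertices incident with its edges. A path of length $l\ge1$ has vertices $p_0,\dots,p_l$. It is an augmenting path for a matching $\mathcal{M}$ if $p_0$ and $p_l$ are not covered by $\mathcal{M}$, each edge $(p_{2i},p_{2i+1})$ is not in $\mathcal{M}$, and each edge $(p_{2i+1},p_{2i+2})$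 is in $\mathcal{M}$ (edges unoriented). An $n$-isomorphism is a definable $C^1$-diffeomorphism $f\colon U\to f(U)$ with $U\subseteq\mathbb{R}^n$ definable and open (and $f(U)$ open) and $|Jf(x)|=1$ for all $x\in U$ ($Jf$ the Jacobian determinant). A definable graph $(V,G)$ is $\lambda$-preserving if there is a partition of $V$ into (finitely many o-minimal) cells such that for each open cell $C$ of this partition, $G\cap(C\times\mathbb{R}^n)$ is a finite union of graphs of $n$-isomorphisms with domain $C$. Construction of $\mathcal{P}$ and $\nu$. An open partition of a definable $X\subseteq\mathbb{R}^n$ is a finite set of pairwise disjoint open cells contained in $X$ whose union covers $X$ outside of a set of $\lambda$-measure 0. It partitions a definable $Y\subseteq X$ if a subset of it is an open partition of $Y$; it refines another open partition of $X$ if it partitions each member of the latter. Let $\pi^{2n}_n\colon\mathbb{R}^{2n}\to\mathbb{R}^n$ be the projection onto the first $n$ coordinates. Let $\mathcal{C}$ be a decomposition of $\mathbb{R}^{2n}$ into cells partitioning $G$ and $M$, and let $\mathcal{A}_0=\{\pi^{2n}_nC\colon C\in\mathcal{C},\ \dim\pi^{2n}_nC=n,\ \pi^{2n}_nC\subseteq A\}=\{A_{0,i}\}_i$, where $\mathcal{C}$ is chosen so that each $G\cap(A_{0,i}\times\mathbb{R}^n)$ is a finite disjoint union of graphs of $n$-isomorphisms with domain $A_{0,i}$ (the cells $C\in\mathcal{C}$, $C\subseteq G$, over $A_{0,i}$); let $\mathcal{F}_{0,i}$ be the set of these isomorphisms. For $0\le m\le K$, given $\mathcal{A}_{2m}=\{A_{2m,i}\}_i$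 and the sets $\mathcal{F}_{2m,i}$: let $\mathcal{B}_{2m+1}=\{B_{2m+1,j}\}_j$ be an open partition of $B$ (refining $\mathcal{B}_{2m-1}$ if $m\ge1$) which partitions $f(A_{2m,i})$ for every $i$ and every $f\in\mathcal{F}_{2m,i}$, and let $\mathcal{F}_{2m+1,j}$ be the set of all restrictions $f^{-1}|_{B_{2m+1,j}}$ with $f\in\bigcup_i\mathcal{F}_{2m,i}$ and $B_{2m+1,j}\subseteq\mathrm{range}(f)$. Then let $\mathcal{A}_{2m+2}=\{A_{2m+2,i}\}_i$ be an open partition of $A$ refining $\mathcal{A}_{2m}$ which partitions $g(B_{2m+1,j})$ for every $j$ and every $g\in\mathcal{F}_{2m+1,j}$, and let $\mathcal{F}_{2m+2,i}$ be the set of all $g^{-1}|_{A_{2m+2,i}}$ with $g\in\bigcup_j\mathcal{F}_{2m+1,j}$ and $A_{2m+2,i}\subseteq\mathrm{range}(g)$. Put $\mathcal{C}_i=\mathcal{A}_i$ for $i$ even and $\mathcal{C}_i=\mathcal{B}_i$ for $i$ odd. $\mathcal{P}$ is the set of paths $p=(p_0,\dots,p_l)$ in $\mathcal{G}$ of length $l\le 2K+1$ such that if $p_0\in A$ then $p_i\in\bigcup\mathcal{C}_i$ for all $i\le l$, and if $p_0\in B$ then $p_i\in\bigcup\mathcal{C}_{i+1}$ for all $i\le l$. The generating sequence of $p\in\mathcal{P}$ of length $l$ is the unique sequence $(g_0,\dots,g_{l-1})$ with $p_{i+1}=g_i(p_i)$ for all $i<l$, where each $g_i\in\mathcal{F}_{i,j}$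 for some $j$ if $p_0\in\bigcup\mathcal{A}_0$, and each $g_i\in\mathcal{F}_{i+1,j}$ for some $j$ if $p_0\in\bigcup\mathcal{B}_1$. For a generating sequence $s$, let $\mathcal{S}_s$ be the set of starting vertices $p_0$ of paths in $\mathcal{P}$ with generating sequence $s$. Identify $\mathcal{P}$ with the (finite) disjoint union $\dot\bigcup_s\mathcal{S}_s$; a definable subset $\mathcal{P}'$ of $\mathcal{P}$ is $\dot\bigcup_s\mathcal{S}'_s$ with $\mathcal{S}'_s\subseteq\mathcal{S}_s$ definable, and $\nu(\mathcal{P}')=\sum_s\lambda(\mathcal{S}'_s)$. *)

theory Defs
  imports "HOL-Analysis.Analysis"
begin

section \<open>First-order expansions of the ordered field of reals and their definable sets\<close>

text \<open>
  The language consists of the language of ordered fields, function symbols from \<open>'f\<close> and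
  relation symbols from \<open>'r\<close>.  An interpretation takes argument lists of every length, so one
  symbol here stands for a family of symbols, one for each arity.  The constants \<open>Const c\<close>
  are the parameters: definable always means definable with parameters.
\<close>

record ('f, 'r) expansion =
  fun_interp :: "'f \<Rightarrow> real list \<Rightarrow> real"
  rel_interp :: "'r \<Rightarrow> real list \<Rightarrow> bool"

datatype 'f fo_term =
    Var nat
  | Const real
  | Plus "'f fo_term" "'f fo_term"
  | Minus "'f fo_term"
  | Times "'f fo_term" "'f fo_term"
  | Fun 'f "'f fo_term list"

datatype ('f, 'r) fo_formula =
    Eq "'f fo_term" "'f fo_term"
  | Less "'f fo_term" "'f fo_term"
  | Rel 'r "'f fo_term list"
  | Neg "('f, 'r) fo_formula"
  | Conj "('f, 'r) fo_formula" "('f, 'r) fo_formula"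
  | Exists nat "('f, 'r) fo_formula"

primrec term_val :: "('f, 'r) expansion \<Rightarrow> (nat \<Rightarrow> real) \<Rightarrow> 'f fo_term \<Rightarrow> real" where
  "term_val R e (Var k) = e k"
| "term_val R e (Const c) = c"
| "term_val R e (Plus s t) = term_val R e s + term_val R e t"
| "term_val R e (Minus t) = - term_val R e t"
| "term_val R e (Times s t) = term_val R e s * term_val R e t"
| "term_val R e (Fun f ts) = fun_interp R f (map (term_val R e) ts)"

primrec satisfies :: "('f, 'r) expansion \<Rightarrow> (nat \<Rightarrow> real) \<Rightarrow> ('f, 'r) fo_formula \<Rightarrow> bool" where
  "satisfies R e (Eq s t) \<longleftrightarrow> term_val R e s = term_val R e t"
| "satisfies R e (Less s t) \<longleftrightarrow> term_val R e s < term_val R e t"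
| "satisfies R e (Rel r ts) \<longleftrightarrow> rel_interp R r (map (term_val R e) ts)"
| "satisfies R e (Neg \<phi>) \<longleftrightarrow> \<not> satisfies R e \<phi>"
| "satisfies R e (Conj \<phi> \<psi>) \<longleftrightarrow> satisfies R e \<phi> \<and> satisfies R e \<psi>"
| "satisfies R e (Exists k \<phi>) \<longleftrightarrow> (\<exists>a. satisfies R (e(k := a)) \<phi>)"

text \<open>
  Cells and definable sets live in all the spaces \<open>\<real>\<^sup>m\<close>, whose points are represented by the
  functions \<open>x :: nat \<Rightarrow> real\<close> with \<open>x k = undefined\<close> for \<open>k \<ge> m\<close>.
  In a formula, a free variable with index \<open>\<ge> m\<close> thus acts as the parameter \<open>undefined\<close>.
\<close>

definition rspace :: "nat \<Rightarrow> (nat \<Rightarrow> real) set" where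
  "rspace m = {..<m} \<rightarrow>\<^sub>E UNIV"

definition definable :: "('f, 'r) expansion \<Rightarrow> nat \<Rightarrow> (nat \<Rightarrow> real) set \<Rightarrow> bool" where
  "definable R m X \<longleftrightarrow> (\<exists>\<phi>. X = {x \<in> rspace m. satisfies R x \<phi>})"

definition o_minimal :: "('f, 'r) expansion \<Rightarrow> bool" where
  "o_minimal R \<longleftrightarrow>
    (\<forall>X. definable R 1 X \<longrightarrow>
      (\<exists>\<I>. finite \<I> \<and> (\<lambda>x. x 0) ` X = \<Union>\<I> \<and>
        (\<forall>I\<in>\<I>. \<exists>a b. I \<in> {{a}, {a<..<b}, {a<..}, {..<b}, UNIV})))"


section \<open>Cells and decompositions\<close>

definition definable_continuous ::
    "('f, 'r) expansion \<Rightarrow> nat \<Rightarrow> (nat \<Rightarrow> real) set \<Rightarrow> ((nat \<Rightarrow> real) \<Rightarrow> real) \<Rightarrow> bool" where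
  "definable_continuous R m X f \<longleftrightarrow>
    definable R (Suc m) ((\<lambda>x. x(m := f x)) ` X) \<and> continuous_on X f"

definition cell_bound ::
    "('f, 'r) expansion \<Rightarrow> nat \<Rightarrow> (nat \<Rightarrow> real) set \<Rightarrow> ((nat \<Rightarrow> real) \<Rightarrow> ereal) \<Rightarrow> bool" where
  "cell_bound R m X f \<longleftrightarrow>
    (\<exists>h. definable_continuous R m X h \<and> (\<forall>x\<in>X. f x = ereal (h x))) \<or>
    (\<forall>x\<in>X. f x = \<infinity>) \<or> (\<forall>x\<in>X. f x = - \<infinity>)"

text \<open>
  \<open>cell R i X\<close>: the set \<open>X\<close> is an \<open>(i\<^sub>1, \<dots>, i\<^sub>m)\<close>-cell, where \<open>m = length i\<close>.
  The induction starts from the one-point space \<open>\<real>\<^sup>0\<close>; points and open intervals of the line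
  are the graphs and bands over it.
\<close>

inductive cell :: "('f, 'r) expansion \<Rightarrow> nat list \<Rightarrow> (nat \<Rightarrow> real) set \<Rightarrow> bool" for R where
  cell_point: "cell R [] (rspace 0)"
| cell_graph: "cell R i X \<Longrightarrow> definable_continuous R (length i) X f \<Longrightarrow>
    cell R (i @ [0]) {x(length i := f x) | x. x \<in> X}"
| cell_band: "cell R i X \<Longrightarrow> cell_bound R (length i) X f \<Longrightarrow> cell_bound R (length i) X g \<Longrightarrow>
    (\<And>x. x \<in> X \<Longrightarrow> f x < g x) \<Longrightarrow>
    cell R (i @ [1]) {x(length i := y) | x y. x \<in> X \<and> f x < ereal y \<and> ereal y < g x}"

definition is_cell :: "('f, 'r) expansion \<Rightarrow> nat \<Rightarrow> (nat \<Rightarrow> real) set \<Rightarrow> bool" where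
  "is_cell R m X \<longleftrightarrow> (\<exists>i. length i = m \<and> cell R i X)"

definition odim :: "('f, 'r) expansion \<Rightarrow> nat \<Rightarrow> (nat \<Rightarrow> real) set \<Rightarrow> nat" where
  "odim R m X = Max {sum_list i | i. length i = m \<and> (\<exists>Y. cell R i Y \<and> Y \<subseteq> X)}"

fun cell_decomposition :: "('f, 'r) expansion \<Rightarrow> nat \<Rightarrow> (nat \<Rightarrow> real) set set \<Rightarrow> bool" where
  "cell_decomposition R 0 \<C> \<longleftrightarrow> \<C> = {rspace 0}"
| "cell_decomposition R (Suc m) \<C> \<longleftrightarrow>
    finite \<C> \<and> partition_on (rspace (Suc m)) \<C> \<and> (\<forall>C\<in>\<C>. is_cell R (Suc m) C) \<and>
    cell_decomposition R m ((`) (\<lambda>x. restrict x {..<m}) ` \<C>)"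


section \<open>The ambient spaces \<open>\<real>\<^sup>n\<close> and \<open>\<real>\<^sup>2\<^sup>n\<close>\<close>

text \<open>
  The dimension \<open>n\<close> is \<open>CARD('n)\<close>; the linear order of the index type is the order of the
  coordinates.  A pair is identified with a point of \<open>\<real>\<^sup>2\<^sup>n\<close>, so that \<open>fst\<close> is the
  projection onto the first \<open>n\<close> coordinates.
\<close>

definition coords :: "real^'n::{finite,wellorder} \<Rightarrow> nat \<Rightarrow> real" where
  "coords x = (\<lambda>k\<in>{..<CARD('n)}. x $ (sorted_list_of_set UNIV ! k))"

definition coords2 ::
    "(real^'n::{finite,wellorder}) \<times> (real^'n::_) \<Rightarrow> nat \<Rightarrow> real" where
  "coords2 p = (\<lambda>k\<in>{..<2 * CARD('n)}.
     if k < CARD('n) then coords (fst p) k else coords (snd p) (k - CARD('n)))"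

definition vdefinable :: "('f, 'r) expansion \<Rightarrow> (real^'n::{finite,wellorder}) set \<Rightarrow> bool" where
  "vdefinable R X \<longleftrightarrow> definable R CARD('n) (coords ` X)"

definition vdefinable2 ::
    "('f, 'r) expansion \<Rightarrow> ((real^'n::{finite,wellorder}) \<times> (real^'n::_)) set \<Rightarrow> bool" where
  "vdefinable2 R E \<longleftrightarrow> definable R (2 * CARD('n)) (coords2 ` E)"

definition vcell :: "('f, 'r) expansion \<Rightarrow> (real^'n::{finite,wellorder}) set \<Rightarrow> bool" where
  "vcell R X \<longleftrightarrow> is_cell R CARD('n) (coords ` X)"

definition vdim :: "('f, 'r) expansion \<Rightarrow> (real^'n::{finite,wellorder}) set \<Rightarrow> nat" where
  "vdim R X = odim R CARD('n) (coords ` X)"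

definition vdecomposition2 ::
    "('f, 'r) expansion \<Rightarrow> ((real^'n::{finite,wellorder}) \<times> (real^'n::_)) set set \<Rightarrow> bool" where
  "vdecomposition2 R \<C> \<longleftrightarrow> cell_decomposition R (2 * CARD('n)) ((`) coords2 ` \<C>)"


section \<open>\<open>n\<close>-isomorphisms\<close>

definition C1_on :: "('a::euclidean_space) set \<Rightarrow> ('a \<Rightarrow> 'a) \<Rightarrow> bool" where
  "C1_on U f \<longleftrightarrow> (\<exists>f' :: 'a \<Rightarrow> ('a \<Rightarrow>\<^sub>L 'a).
     (\<forall>x\<in>U. (f has_derivative blinfun_apply (f' x)) (at x)) \<and> continuous_on U f')"

definition graph_on :: "'a set \<Rightarrow> ('a \<Rightarrow> 'b) \<Rightarrow> ('a \<times> 'b) set" where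
  "graph_on U f = (\<lambda>x. (x, f x)) ` U"

definition n_isomorphism :: "('f, 'r) expansion \<Rightarrow> (real^'n::{finite,wellorder}) set \<Rightarrow>
    ((real^'n::_) \<Rightarrow> (real^'n::_)) \<Rightarrow> bool" where
  "n_isomorphism R U f \<longleftrightarrow>
    vdefinable R U \<and> open U \<and> vdefinable2 R (graph_on U f) \<and>
    open (f ` U) \<and> inj_on f U \<and> C1_on U f \<and> C1_on (f ` U) (inv_into U f) \<and>
    (\<forall>x\<in>U. \<bar>det (matrix (frechet_derivative f (at x)))\<bar> = 1)"


section \<open>Graphs, matchings and augmenting paths\<close>

definition definable_bipartite_graph :: "('f, 'r) expansion \<Rightarrow>
    (real^'n::{finite,wellorder}) set \<Rightarrow> (real^'n::_) set \<Rightarrow> ((real^'n::_) \<times> (real^'n::_)) set \<Rightarrow> bool" where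
  "definable_bipartite_graph R A B G \<longleftrightarrow>
    vdefinable R A \<and> vdefinable R B \<and> A \<inter> B = {} \<and> A \<union> B \<noteq> {} \<and>
    vdefinable2 R G \<and> sym G \<and> irrefl G \<and> G \<subseteq> A \<times> B \<union> B \<times> A"

definition lambda_preserving :: "('f, 'r) expansion \<Rightarrow>
    (real^'n::{finite,wellorder}) set \<Rightarrow> ((real^'n::_) \<times> (real^'n::_)) set \<Rightarrow> bool" where
  "lambda_preserving R V G \<longleftrightarrow>
    (\<exists>\<D>. finite \<D> \<and> partition_on V \<D> \<and> (\<forall>C\<in>\<D>. vcell R C) \<and>
      (\<forall>C\<in>\<D>. open C \<longrightarrow>
        (\<exists>\<Phi>. finite \<Phi> \<and> (\<forall>f\<in>\<Phi>. n_isomorphism R C f) \<and>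
          G \<inter> (C \<times> UNIV) = (\<Union>f\<in>\<Phi>. graph_on C f))))"

text \<open>The edge relation contains both orientations of an edge, a matching only the one from
  \<open>A\<close> to \<open>B\<close>.\<close>

definition matching :: "'a set \<Rightarrow> 'a set \<Rightarrow> ('a \<times> 'a) set \<Rightarrow> ('a \<times> 'a) set \<Rightarrow> bool" where
  "matching A B G M \<longleftrightarrow>
    M \<subseteq> G \<and> (\<exists>X Y f. X \<subseteq> A \<and> Y \<subseteq> B \<and> bij_betw f X Y \<and> M = graph_on X f)"

definition covered :: "('a \<times> 'a) set \<Rightarrow> 'a set" where
  "covered M = fst ` M \<union> snd ` M"

text \<open>The path \<open>p\<^sub>0, \<dots>, p\<^sub>l\<close> is a list of length \<open>l + 1\<close>.\<close>

definition path_length :: "'a list \<Rightarrow> nat" where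
  "path_length p = length p - 1"

definition is_path :: "('a \<times> 'a) set \<Rightarrow> 'a list \<Rightarrow> bool" where
  "is_path G p \<longleftrightarrow> 2 \<le> length p \<and> distinct p \<and> (\<forall>i<path_length p. (p ! i, p ! Suc i) \<in> G)"

definition augmenting_path ::
    "('a \<times> 'a) set \<Rightarrow> ('a \<times> 'a) set \<Rightarrow> 'a list \<Rightarrow> bool" where
  "augmenting_path G M p \<longleftrightarrow>
    is_path G p \<and> hd p \<notin> covered M \<and> last p \<notin> covered M \<and>
    (\<forall>i<path_length p. (p ! i, p ! Suc i) \<in> M \<union> M\<inverse> \<longleftrightarrow> odd i)"


section \<open>The set of generic paths and its measure\<close>

definition open_partition :: "('f, 'r) expansion \<Rightarrow>
    (real^'n::{finite,wellorder}) set \<Rightarrow> (real^'n::_) set set \<Rightarrow> bool" where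
  "open_partition R X \<D> \<longleftrightarrow>
    finite \<D> \<and> disjoint \<D> \<and> (\<forall>C\<in>\<D>. vcell R C \<and> open C \<and> C \<subseteq> X) \<and>
    X - \<Union>\<D> \<in> null_sets lebesgue"

definition partitions :: "('f, 'r) expansion \<Rightarrow>
    (real^'n::{finite,wellorder}) set set \<Rightarrow> (real^'n::_) set \<Rightarrow> bool" where
  "partitions R \<D> Y \<longleftrightarrow> (\<exists>\<E>\<subseteq>\<D>. open_partition R Y \<E>)"

definition refines :: "('f, 'r) expansion \<Rightarrow> (real^'n::{finite,wellorder}) set \<Rightarrow>
    (real^'n::_) set set \<Rightarrow> (real^'n::_) set set \<Rightarrow> bool" where
  "refines R X \<D> \<E> \<longleftrightarrow>
    open_partition R X \<D> \<and> open_partition R X \<E> \<and> (\<forall>C\<in>\<E>. partitions R \<D> C)"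

text \<open>
  \<open>Cs i\<close> is the open partition \<open>\<A>\<^sub>i\<close> of \<open>A\<close> (\<open>i\<close> even) or \<open>\<B>\<^sub>i\<close> of \<open>B\<close> (\<open>i\<close> odd),
  for \<open>i \<le> 2K + 2\<close>, and \<open>Fs i X\<close> is the set of maps attached to its member \<open>X\<close>.
  Maps with domain \<open>X\<close> are represented by functions that are \<open>undefined\<close> outside \<open>X\<close>, so that
  distinct members of \<open>Fs i X\<close> are distinct as maps on \<open>X\<close>.
\<close>

definition initial_family :: "('f, 'r) expansion \<Rightarrow> (real^'n::{finite,wellorder}) set \<Rightarrow>
    ((real^'n::_) \<times> (real^'n::_)) set set \<Rightarrow> (real^'n::_) set set" where
  "initial_family R A \<C> =
    {fst ` C | C. C \<in> \<C> \<and> vdim R (fst ` C) = CARD('n) \<and> fst ` C \<subseteq> A}"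

definition initial_maps :: "('f, 'r) expansion \<Rightarrow>
    ((real^'n::{finite,wellorder}) \<times> (real^'n::_)) set \<Rightarrow> ((real^'n::_) \<times> (real^'n::_)) set set \<Rightarrow>
    (real^'n::_) set \<Rightarrow> ((real^'n::_) \<Rightarrow> (real^'n::_)) set" where
  "initial_maps R G \<C> X =
    {f \<in> extensional X. n_isomorphism R X f \<and> graph_on X f \<in> \<C> \<and> graph_on X f \<subseteq> G}"

definition inverse_maps ::
    "'a set set \<Rightarrow> ('a set \<Rightarrow> ('a \<Rightarrow> 'a) set) \<Rightarrow> 'a set \<Rightarrow> ('a \<Rightarrow> 'a) set" where
  "inverse_maps \<D> F Y =
    {restrict (inv_into X f) Y | X f. X \<in> \<D> \<and> f \<in> F X \<and> Y \<subseteq> f ` X}"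

definition path_construction :: "('f, 'r) expansion \<Rightarrow>
    (real^'n::{finite,wellorder}) set \<Rightarrow> (real^'n::_) set \<Rightarrow>
    ((real^'n::_) \<times> (real^'n::_)) set \<Rightarrow> ((real^'n::_) \<times> (real^'n::_)) set \<Rightarrow> nat \<Rightarrow>
    ((real^'n::_) \<times> (real^'n::_)) set set \<Rightarrow>
    (nat \<Rightarrow> (real^'n::_) set set) \<Rightarrow>
    (nat \<Rightarrow> (real^'n::_) set \<Rightarrow> ((real^'n::_) \<Rightarrow> (real^'n::_)) set) \<Rightarrow> bool" where
  "path_construction R A B G M K \<C> Cs Fs \<longleftrightarrow>
    vdecomposition2 R \<C> \<and>
    (\<forall>C\<in>\<C>. C \<subseteq> G \<or> C \<inter> G = {}) \<and> (\<forall>C\<in>\<C>. C \<subseteq> M \<or> C \<inter> M = {}) \<and>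
    Cs 0 = initial_family R A \<C> \<and>
    (\<forall>X\<in>Cs 0. Fs 0 X = initial_maps R G \<C> X \<and>
       G \<inter> (X \<times> UNIV) = (\<Union>f\<in>Fs 0 X. graph_on X f)) \<and>
    (\<forall>i<2 * K + 2.
       open_partition R (if even i then B else A) (Cs (Suc i)) \<and>
       (i \<ge> 1 \<longrightarrow> refines R (if even i then B else A) (Cs (Suc i)) (Cs (i - 1))) \<and>
       (\<forall>X\<in>Cs i. \<forall>f\<in>Fs i X. partitions R (Cs (Suc i)) (f ` X)) \<and>
       (\<forall>Y\<in>Cs (Suc i). Fs (Suc i) Y = inverse_maps (Cs i) (Fs i) Y))"

definition start_index :: "'a set \<Rightarrow> 'a list \<Rightarrow> nat" where
  "start_index A p = (if hd p \<in> A then 0 else 1)"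

definition generic_paths ::
    "'a set \<Rightarrow> ('a \<times> 'a) set \<Rightarrow> nat \<Rightarrow> (nat \<Rightarrow> 'a set set) \<Rightarrow> 'a list set" where
  "generic_paths A G K Cs =
    {p. is_path G p \<and> path_length p \<le> 2 * K + 1 \<and>
        (\<forall>i<length p. p ! i \<in> \<Union>(Cs (start_index A p + i)))}"

definition generating_sequence :: "'a set \<Rightarrow> (nat \<Rightarrow> 'a set set) \<Rightarrow>
    (nat \<Rightarrow> 'a set \<Rightarrow> ('a \<Rightarrow> 'a) set) \<Rightarrow> 'a list \<Rightarrow> ('a \<Rightarrow> 'a) list \<Rightarrow> bool" where
  "generating_sequence A Cs Fs p s \<longleftrightarrow>
    length s = path_length p \<and>
    (\<forall>i<path_length p. \<exists>X\<in>Cs (start_index A p + i).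
       s ! i \<in> Fs (start_index A p + i) X \<and> p ! i \<in> X \<and> p ! Suc i = (s ! i) (p ! i))"

text \<open>The part of a set \<open>Q\<close> of paths that lies in the summand \<open>\<S>\<^sub>s\<close>.\<close>

definition starting_vertices :: "'a set \<Rightarrow> (nat \<Rightarrow> 'a set set) \<Rightarrow>
    (nat \<Rightarrow> 'a set \<Rightarrow> ('a \<Rightarrow> 'a) set) \<Rightarrow> 'a list set \<Rightarrow> ('a \<Rightarrow> 'a) list \<Rightarrow> 'a set" where
  "starting_vertices A Cs Fs Q s = {hd p | p. p \<in> Q \<and> generating_sequence A Cs Fs p s}"

definition definable_paths :: "('f, 'r) expansion \<Rightarrow>
    (real^'n::{finite,wellorder}) set \<Rightarrow> (nat \<Rightarrow> (real^'n::_) set set) \<Rightarrow>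
    (nat \<Rightarrow> (real^'n::_) set \<Rightarrow> ((real^'n::_) \<Rightarrow> (real^'n::_)) set) \<Rightarrow> (real^'n::_) list set \<Rightarrow> bool" where
  "definable_paths R A Cs Fs Q \<longleftrightarrow> (\<forall>s. vdefinable R (starting_vertices A Cs Fs Q s))"

text \<open>The index set of the sum, the set of generating sequences of paths in \<open>P\<close>, is finite
  for data satisfying \<open>path_construction\<close>.\<close>

definition path_measure :: "(real^'n::{finite,wellorder}) set \<Rightarrow>
    (nat \<Rightarrow> (real^'n::_) set set) \<Rightarrow> (nat \<Rightarrow> (real^'n::_) set \<Rightarrow> ((real^'n::_) \<Rightarrow> (real^'n::_)) set) \<Rightarrow>
    (real^'n::_) list set \<Rightarrow> (real^'n::_) list set \<Rightarrow> ennreal" where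
  "path_measure A Cs Fs P Q =
    (\<Sum>s\<in>{s. \<exists>p\<in>P. generating_sequence A Cs Fs p s}.
       emeasure lebesgue (starting_vertices A Cs Fs Q s))"

end

theory Submission
  imports Defs
begin

text \<open>
  Among the definable matchings in \<open>G\<close> that cover the vertices covered by \<open>M\<close>, choose \<open>M'\<close> such
  that the outer measure of the set of covered vertices is within \<open>\<epsilon>\<close> of the supremum.  The starting
  vertex of a path with generating sequence \<open>s\<close> has a neighbourhood, a box, in which distinct
  points start vertex-disjoint paths with generating sequence \<open>s\<close>.  All augmenting paths of \<open>M'\<close>
  with generating sequence \<open>s\<close> starting in such a box can be flipped at once; this covers their
  starting vertices in addition, so by the choice of \<open>M'\<close> these form a set of measure at most \<open>\<epsilon>\<close>.
  Up to a set of small measure the starting vertices lie in finitely many such boxes, which are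
  fixed, together with \<open>\<epsilon>\<close>, before \<open>M'\<close> is chosen.
\<close>

section \<open>Closure properties of definability\<close>

text \<open>The obstacle is that orbits of distinct starting points under one generating sequence
  may meet, even at different positions, so a definable set of augmenting paths cannot in general be
  flipped simultaneously. Near a single path this is excluded: its vertices are distinct, and the
  maps along it are continuous and injective on open sets. Whether a box is suitable does not depend
  on the matching, which is what allows the boxes to be fixed in advance. An exchange keeps every
  covered vertex covered, so the covered set gains at least the starting vertices, and it is this
  gain that is measured. A near-maximal matching takes the place of a limit of repeated exchanges,
  which need not be definable. Each exchange stays definable because the vertices of a path are
  definable functions of its start, so that being augmenting becomes finitely many first-order
  conditions on one point.\<close>

definition fo_definable :: "('f, 'r) expansion \<Rightarrow> ((nat \<Rightarrow> real) \<Rightarrow> bool) \<Rightarrow> bool" where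
  "fo_definable R P \<longleftrightarrow> (\<exists>\<phi>. \<forall>e. satisfies R e \<phi> \<longleftrightarrow> P e)"

lemma fo_definableI: "(\<And>e. satisfies R e \<phi> \<longleftrightarrow> P e) \<Longrightarrow> fo_definable R P"
  unfolding fo_definable_def by blast

lemma fo_definable_cong: "fo_definable R P \<Longrightarrow> (\<And>e. P e \<longleftrightarrow> Q e) \<Longrightarrow> fo_definable R Q"
  unfolding fo_definable_def by simp

lemma fo_definable_less: "fo_definable R (\<lambda>e. term_val R e s < term_val R e t)"
  by (rule fo_definableI[where \<phi> = "Less s t"]) simp

lemma fo_definable_eq: "fo_definable R (\<lambda>e. term_val R e s = term_val R e t)"
  by (rule fo_definableI[where \<phi> = "Eq s t"]) simp

lemma fo_definable_not: "fo_definable R P \<Longrightarrow> fo_definable R (\<lambda>e. \<not> P e)"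
  unfolding fo_definable_def by (metis satisfies.simps(4))

lemma fo_definable_conj:
  "fo_definable R P \<Longrightarrow> fo_definable R Q \<Longrightarrow> fo_definable R (\<lambda>e. P e \<and> Q e)"
  unfolding fo_definable_def by (metis satisfies.simps(5))

lemma fo_definable_const: "fo_definable R (\<lambda>e. b)"
proof -
  have "fo_definable R (\<lambda>e. term_val R e (Const 0) = term_val R e (Const (if b then 0 else 1)))"
    by (rule fo_definable_eq)
  then show ?thesis
    by (rule fo_definable_cong) simp
qed

lemma fo_definable_ball:
  "finite I \<Longrightarrow> (\<And>i. i \<in> I \<Longrightarrow> fo_definable R (P i)) \<Longrightarrow> fo_definable R (\<lambda>e. \<forall>i\<in>I. P i e)"
proof (induction I rule: finite_induct)
  case empty
  then show ?case by (simp add: fo_definable_const)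
next
  case (insert i I)
  then have "fo_definable R (\<lambda>e. P i e \<and> (\<forall>i\<in>I. P i e))"
    by (intro fo_definable_conj) auto
  then show ?case by simp
qed

lemma fo_definable_ex: "fo_definable R P \<Longrightarrow> fo_definable R (\<lambda>e. \<exists>a. P (e(k := a)))"
  unfolding fo_definable_def by (metis satisfies.simps(6))

lemma fo_definable_ex_vars:
  "finite K \<Longrightarrow> fo_definable R P \<Longrightarrow>
    fo_definable R (\<lambda>e. \<exists>f. P (\<lambda>k. if k \<in> K then f k else e k))"
proof (induction K rule: finite_induct)
  case empty
  then show ?case by simp
next
  case (insert k K)
  have eq: "(\<exists>f. P (\<lambda>k'. if k' \<in> insert k K then f k' else e k')) \<longleftrightarrow>
      (\<exists>a f. P (\<lambda>k'. if k' \<in> K then f k' else (e(k := a)) k'))" for e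
  proof (intro iffI; elim exE)
    fix f assume "P (\<lambda>k'. if k' \<in> insert k K then f k' else e k')"
    moreover have "(\<lambda>k'. if k' \<in> insert k K then f k' else e k') =
        (\<lambda>k'. if k' \<in> K then f k' else (e(k := f k)) k')"
      by auto
    ultimately show "\<exists>a f. P (\<lambda>k'. if k' \<in> K then f k' else (e(k := a)) k')"
      by metis
  next
    fix a f assume "P (\<lambda>k'. if k' \<in> K then f k' else (e(k := a)) k')"
    moreover have "(\<lambda>k'. if k' \<in> K then f k' else (e(k := a)) k') =
        (\<lambda>k'. if k' \<in> insert k K then (f(k := a)) k' else e k')"
      using insert.hyps by auto
    ultimately show "\<exists>f. P (\<lambda>k'. if k' \<in> insert k K then f k' else e k')"
      by metis
  qed
  show ?case
    unfolding eq using insert by (intro fo_definable_ex) simp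
qed

section \<open>Substitution of terms into formulas\<close>

text \<open>Environments are infinite, but a term or formula reads only an initial segment of one.
  The bound \<open>N\<close> is what provides a fresh variable when substituting under a
  quantifier.\<close>

definition finite_support :: "((nat \<Rightarrow> real) \<Rightarrow> 'b) \<Rightarrow> bool" where
  "finite_support F \<longleftrightarrow> (\<exists>N. \<forall>e e'. (\<forall>k<N. e k = e' k) \<longrightarrow> F e = F e')"

lemma finite_support_binary:
  assumes "finite_support F" "finite_support G"
  shows "finite_support (\<lambda>e. c (F e) (G e))"
proof -
  obtain N N' where N: "\<And>e e'. (\<forall>k<N. e k = e' k) \<Longrightarrow> F e = F e'"
    "\<And>e e'. (\<forall>k<N'. e k = e' k) \<Longrightarrow> G e = G e'"
    using assms unfolding finite_support_def by blast
  have "c (F e) (G e) = c (F e') (G e')" if "\<forall>k<max N N'. e k = e' k" for e e'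
    using N(1)[of e e'] N(2)[of e e'] that by simp
  then show ?thesis unfolding finite_support_def by blast
qed

lemma finite_support_map:
  assumes "\<And>t. t \<in> set ts \<Longrightarrow> finite_support (\<lambda>e. F e t)"
  shows "finite_support (\<lambda>e. c (map (F e) ts))"
proof -
  have "finite_support (\<lambda>e. map (F e) ts)"
    using assms
  proof (induction ts)
    case Nil
    then show ?case by (simp add: finite_support_def)
  next
    case (Cons t ts)
    then show ?case by (simp add: finite_support_binary[where c = "(#)"])
  qed
  then show ?thesis
    unfolding finite_support_def by metis
qed

lemma finite_support_term_val: "finite_support (\<lambda>e. term_val R e t)"
proof (induction t)
  case (Var k)
  show ?case unfolding finite_support_def by (rule exI[of _ "Suc k"]) simp
next
  case (Const c)
  show ?case by (simp add: finite_support_def)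
next
  case (Plus s t)
  then show ?case by (simp add: finite_support_binary[where c = "(+)"])
next
  case (Minus t)
  from finite_support_binary[OF this this, where c = "\<lambda>x y. - x"] show ?case by simp
next
  case (Times s t)
  then show ?case by (simp add: finite_support_binary[where c = "(*)"])
next
  case (Fun f ts)
  then show ?case by (simp add: finite_support_map[where c = "fun_interp R f"])
qed

lemma finite_support_satisfies: "finite_support (\<lambda>e. satisfies R e \<phi>)"
proof (induction \<phi>)
  case (Eq s t)
  show ?case by (simp add: finite_support_binary[where c = "(=)"] finite_support_term_val)
next
  case (Less s t)
  show ?case by (simp add: finite_support_binary[where c = "(<)"] finite_support_term_val)
next
  case (Rel r ts)
  show ?case by (simp add: finite_support_map[where c = "rel_interp R r"] finite_support_term_val)
next
  case (Neg \<phi>)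
  from finite_support_binary[OF this this, where c = "\<lambda>x y. \<not> x"] show ?case by simp
next
  case (Conj \<phi> \<psi>)
  then show ?case by (simp add: finite_support_binary[where c = "(\<and>)"])
next
  case (Exists j \<phi>)
  then obtain N where N: "\<And>e e'. (\<forall>k<N. e k = e' k) \<Longrightarrow> satisfies R e \<phi> = satisfies R e' \<phi>"
    unfolding finite_support_def by blast
  have "satisfies R (e(j := a)) \<phi> = satisfies R (e'(j := a)) \<phi>" if "\<forall>k<N. e k = e' k" for e e' a
    using that by (intro N) simp
  then show ?case
    unfolding finite_support_def by (intro exI[of _ N] allI impI) (metis satisfies.simps(6))
qed

primrec subst_term :: "(nat \<Rightarrow> 'f fo_term) \<Rightarrow> 'f fo_term \<Rightarrow> 'f fo_term" where
  "subst_term t (Var k) = t k"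
| "subst_term t (Const c) = Const c"
| "subst_term t (Plus u v) = Plus (subst_term t u) (subst_term t v)"
| "subst_term t (Minus u) = Minus (subst_term t u)"
| "subst_term t (Times u v) = Times (subst_term t u) (subst_term t v)"
| "subst_term t (Fun f us) = Fun f (map (subst_term t) us)"

lemma term_val_subst: "term_val R e (subst_term t u) = term_val R (\<lambda>k. term_val R e (t k)) u"
  by (induction u) (auto simp: comp_def cong: map_cong)

text \<open>Only the existence of a substituted formula is claimed, so renaming bound variables
  needs no syntactic operation on formulas. Under a quantifier the bound \<open>j\<close> is sent to
  a fresh variable \<open>z\<close> by altering the substitution itself, which is why
  \<open>t\<close> is arbitrary in the induction.\<close>

lemma satisfies_subst:
  "\<exists>\<psi>. \<forall>e. satisfies R e \<psi> \<longleftrightarrow> satisfies R (\<lambda>k. term_val R e (t k)) \<phi>"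
proof (induction \<phi> arbitrary: t)
  case (Eq u v)
  show ?case by (rule exI[of _ "Eq (subst_term t u) (subst_term t v)"]) (simp add: term_val_subst)
next
  case (Less u v)
  show ?case by (rule exI[of _ "Less (subst_term t u) (subst_term t v)"]) (simp add: term_val_subst)
next
  case (Rel r us)
  show ?case by (rule exI[of _ "Rel r (map (subst_term t) us)"]) (simp add: term_val_subst comp_def)
next
  case (Neg \<phi>)
  then show ?case by (metis satisfies.simps(4))
next
  case (Conj \<phi> \<psi>)
  then show ?case by (metis satisfies.simps(5))
next
  case (Exists j \<phi>)
  obtain N where N: "\<And>e e'. (\<forall>k<N. e k = e' k) \<Longrightarrow> satisfies R e \<phi> = satisfies R e' \<phi>"
    using finite_support_satisfies unfolding finite_support_def by metis
  obtain L where L: "\<And>u e e'. (\<forall>k<L u. e k = e' k) \<Longrightarrow> term_val R e u = term_val R e' u"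
    using finite_support_term_val unfolding finite_support_def by metis
  \<comment> \<open>\<open>z\<close> lies beyond every index read by the terms \<open>t k\<close>
    with \<open>k < N\<close>, and \<open>\<phi>\<close> reads no other variables; hence quantifying
    over \<open>z\<close> captures nothing.\<close>
  define z where "z = Max (insert 0 ((\<lambda>k. L (t k)) ` {..<N}))"
  have z: "term_val R (e(z := a)) (t k) = term_val R e (t k)" if "k < N" for e a k
  proof -
    have "L (t k) \<le> z" unfolding z_def using that by (intro Max_ge) auto
    then show ?thesis by (intro L) auto
  qed
  obtain \<psi> where \<psi>: "\<And>e. satisfies R e \<psi> \<longleftrightarrow>
      satisfies R (\<lambda>k. term_val R e (if k = j then Var z else t k)) \<phi>"
    using Exists.IH by metis
  have "satisfies R (e(z := a)) \<psi> = satisfies R ((\<lambda>k. term_val R e (t k))(j := a)) \<phi>" for e a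
    unfolding \<psi> by (intro N) (simp add: z)
  then show ?case
    by (intro exI[of _ "Exists z \<psi>"]) simp
qed

lemma fo_definable_subst:
  "fo_definable R P \<Longrightarrow> fo_definable R (\<lambda>e. P (\<lambda>k. term_val R e (t k)))"
  unfolding fo_definable_def by (metis satisfies_subst)

text \<open>Passage between subsets of a fixed \<open>rspace m\<close> and predicates on all
  environments. On the latter, Boolean operations and quantifiers need no bookkeeping of the ambient
  dimension.\<close>

lemma definable_iff:
  "definable R m X \<longleftrightarrow> X \<subseteq> rspace m \<and> fo_definable R (\<lambda>e. restrict e {..<m} \<in> X)"
proof
  assume "definable R m X"
  then obtain \<phi> where X: "X = {x \<in> rspace m. satisfies R x \<phi>}"
    unfolding definable_def by blast
  have "fo_definable R (\<lambda>e. satisfies R e \<phi>)"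
    by (rule fo_definableI) simp
  \<comment> \<open>Variables of index at least \<open>m\<close> are replaced by the parameter
    \<open>undefined\<close>, the value that points of \<open>rspace m\<close> take there.\<close>
  from fo_definable_subst[OF this, of "\<lambda>k. if k < m then Var k else Const undefined"]
  have "fo_definable R (\<lambda>e. satisfies R (restrict e {..<m}) \<phi>)"
    by (rule fo_definable_cong) (auto intro!: arg_cong[where f = "\<lambda>e. satisfies R e \<phi>"])
  then show "X \<subseteq> rspace m \<and> fo_definable R (\<lambda>e. restrict e {..<m} \<in> X)"
    by (auto simp: X rspace_def)
next
  assume *: "X \<subseteq> rspace m \<and> fo_definable R (\<lambda>e. restrict e {..<m} \<in> X)"
  then obtain \<phi> where "\<And>e. satisfies R e \<phi> \<longleftrightarrow> restrict e {..<m} \<in> X"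
    unfolding fo_definable_def by blast
  moreover have "restrict x {..<m} = x" if "x \<in> rspace m" for x
    using that by (auto simp: rspace_def PiE_restrict)
  ultimately have "X = {x \<in> rspace m. satisfies R x \<phi>}"
    using * by auto
  then show "definable R m X"
    unfolding definable_def by blast
qed

lemma fo_definable_mem:
  assumes "definable R m X"
  shows "fo_definable R (\<lambda>e. (\<lambda>k\<in>{..<m}. e (r k)) \<in> X)"
proof -
  have "fo_definable R (\<lambda>e. restrict e {..<m} \<in> X)"
    using assms by (simp add: definable_iff)
  from fo_definable_subst[OF this, of "\<lambda>k. Var (r k)"] show ?thesis
    by simp
qed

section \<open>Definability of cells\<close>

text \<open>A finite bound is given only through its graph, so comparing it with the last coordinate
  takes an existential quantifier over its value, held in variable \<open>Suc m\<close>. Infinite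
  bounds turn each condition into membership in \<open>X\<close> or into falsity.\<close>

lemma cell_bound_definable:
  assumes X: "X \<subseteq> rspace m" "definable R m X" and f: "cell_bound R m X f"
  shows "fo_definable R (\<lambda>e. restrict e {..<m} \<in> X \<and> f (restrict e {..<m}) < ereal (e m))" (is ?L)
    and "fo_definable R (\<lambda>e. restrict e {..<m} \<in> X \<and> ereal (e m) < f (restrict e {..<m}))" (is ?U)
proof -
  have X': "fo_definable R (\<lambda>e. restrict e {..<m} \<in> X)"
    using X by (simp add: definable_iff)
  consider h where "definable_continuous R m X h" "\<forall>x\<in>X. f x = ereal (h x)"
    | "\<forall>x\<in>X. f x = \<infinity>" | "\<forall>x\<in>X. f x = - \<infinity>"
    using f unfolding cell_bound_def by blast
  then have "?L \<and> ?U"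
  proof cases
    case (1 h)
    let ?\<Gamma> = "(\<lambda>x. x(m := h x)) ` X"
    have graph: "(\<lambda>k\<in>{..<Suc m}. (e(Suc m := z)) (if k = m then Suc m else k)) \<in> ?\<Gamma> \<longleftrightarrow>
        restrict e {..<m} \<in> X \<and> z = h (restrict e {..<m})" for e :: "nat \<Rightarrow> real" and z
    proof -
      have eq: "(\<lambda>k\<in>{..<Suc m}. (e(Suc m := z)) (if k = m then Suc m else k)) =
          (restrict e {..<m})(m := z)"
        by (auto simp: fun_eq_iff less_Suc_eq)
      \<comment> \<open>Points of \<open>X\<close> are \<open>undefined\<close> at index
        \<open>m\<close>, so overwriting that index loses no information and \<open>x\<close> can be
        recovered.\<close>
      have "(restrict e {..<m})(m := z) = x(m := h x) \<longleftrightarrow> x = restrict e {..<m} \<and> z = h x"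
        if "x \<in> X" for x
      proof
        assume *: "(restrict e {..<m})(m := z) = x(m := h x)"
        have "x \<in> extensional {..<m}"
          using that X(1) by (auto simp: rspace_def PiE_def)
        then have "x k = restrict e {..<m} k" for k
          using fun_cong[OF *, of k] by (cases "k = m") (auto simp: extensional_def)
        then show "x = restrict e {..<m} \<and> z = h x"
          using fun_cong[OF *, of m] by auto
      qed auto
      then show ?thesis
        unfolding eq by auto
    qed
    have "definable R (Suc m) ?\<Gamma>"
      using 1 by (simp add: definable_continuous_def)
    note mem = fo_definable_mem[OF this, of "\<lambda>k. if k = m then Suc m else k"]
    have "fo_definable R (\<lambda>e. (\<lambda>k\<in>{..<Suc m}. e (if k = m then Suc m else k)) \<in> ?\<Gamma> \<and>
        term_val R e (Var (Suc m)) < term_val R e (Var m))"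
      by (intro fo_definable_conj mem fo_definable_less)
    from fo_definable_ex[OF this, of "Suc m"] have ?L
      unfolding graph using 1 by (elim fo_definable_cong) auto
    moreover have "fo_definable R (\<lambda>e. (\<lambda>k\<in>{..<Suc m}. e (if k = m then Suc m else k)) \<in> ?\<Gamma> \<and>
        term_val R e (Var m) < term_val R e (Var (Suc m)))"
      by (intro fo_definable_conj mem fo_definable_less)
    from fo_definable_ex[OF this, of "Suc m"] have ?U
      unfolding graph using 1 by (elim fo_definable_cong) auto
    ultimately show ?thesis ..
  next
    case 2
    then have "?L \<longleftrightarrow> fo_definable R (\<lambda>e. False)" "?U \<longleftrightarrow> fo_definable R (\<lambda>e. restrict e {..<m} \<in> X)"
      by (auto intro!: arg_cong[where f = "fo_definable R"])
    then show ?thesis using X' by (simp add: fo_definable_const)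
  next
    case 3
    then have "?U \<longleftrightarrow> fo_definable R (\<lambda>e. False)" "?L \<longleftrightarrow> fo_definable R (\<lambda>e. restrict e {..<m} \<in> X)"
      by (auto intro!: arg_cong[where f = "fo_definable R"])
    then show ?thesis using X' by (simp add: fo_definable_const)
  qed
  then show ?L ?U by auto
qed

lemma cell_definable: "cell R i X \<Longrightarrow> definable R (length i) X"
proof (induction rule: cell.induct)
  case cell_point
  show ?case by (auto simp: definable_iff rspace_def restrict_def fo_definable_const)
next
  case (cell_graph i X f)
  then show ?case by (simp add: definable_continuous_def setcompr_eq_image)
next
  case (cell_band i X f g)
  let ?m = "length i"
  let ?Y = "{x(?m := y) | x y. x \<in> X \<and> f x < ereal y \<and> ereal y < g x}"
  have X: "X \<subseteq> rspace ?m" using cell_band.IH by (simp add: definable_iff)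
  have "fo_definable R (\<lambda>e. (restrict e {..<?m} \<in> X \<and> f (restrict e {..<?m}) < ereal (e ?m)) \<and>
      (restrict e {..<?m} \<in> X \<and> ereal (e ?m) < g (restrict e {..<?m})))"
    by (rule fo_definable_conj[OF cell_bound_definable(1)[OF X cell_band.IH cell_band.hyps(2)]
          cell_bound_definable(2)[OF X cell_band.IH cell_band.hyps(3)]])
  moreover have "restrict e {..<Suc ?m} \<in> ?Y \<longleftrightarrow>
      (restrict e {..<?m} \<in> X \<and> f (restrict e {..<?m}) < ereal (e ?m)) \<and>
      (restrict e {..<?m} \<in> X \<and> ereal (e ?m) < g (restrict e {..<?m}))" for e :: "nat \<Rightarrow> real"
  proof -
    have eq: "restrict e {..<Suc ?m} = (restrict e {..<?m})(?m := e ?m)"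
      by (auto simp: fun_eq_iff less_Suc_eq)
    have key: "(restrict e {..<?m})(?m := e ?m) = x(?m := y) \<longleftrightarrow> x = restrict e {..<?m} \<and> y = e ?m"
      if "x \<in> X" for x y
    proof
      assume *: "(restrict e {..<?m})(?m := e ?m) = x(?m := y)"
      have "x \<in> extensional {..<?m}"
        using that X by (auto simp: rspace_def PiE_def)
      then have "x k = restrict e {..<?m} k" for k
        using fun_cong[OF *, of k] by (cases "k = ?m") (auto simp: extensional_def)
      then show "x = restrict e {..<?m} \<and> y = e ?m"
        using fun_cong[OF *, of ?m] by auto
    qed auto
    have "restrict e {..<Suc ?m} \<in> ?Y \<longleftrightarrow>
        (\<exists>x\<in>X. \<exists>y. (restrict e {..<?m})(?m := e ?m) = x(?m := y) \<and> f x < ereal y \<and> ereal y < g x)"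
      unfolding eq by auto
    also have "\<dots> \<longleftrightarrow>
        (\<exists>x\<in>X. \<exists>y. (x = restrict e {..<?m} \<and> y = e ?m) \<and> f x < ereal y \<and> ereal y < g x)"
      by (intro bex_cong refl) (simp only: key)
    finally show ?thesis by auto
  qed
  ultimately have "fo_definable R (\<lambda>e. restrict e {..<Suc ?m} \<in> ?Y)"
    by simp
  moreover have "?Y \<subseteq> rspace (Suc ?m)"
    using X by (force simp: rspace_def PiE_def extensional_def)
  ultimately show ?case
    by (simp add: definable_iff)
qed

lemma vcell_vdefinable: "vcell R X \<Longrightarrow> vdefinable R X"
  unfolding vcell_def is_cell_def vdefinable_def by (auto dest: cell_definable)

section \<open>Definability with variables ranging over \<open>\<real>\<^sup>n\<close>\<close>

definition coord_index :: "'n::{finite,wellorder} \<Rightarrow> nat" where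
  "coord_index = inv_into {..<CARD('n)} ((!) (sorted_list_of_set UNIV))"

lemma bij_betw_nth_UNIV: "bij_betw ((!) (sorted_list_of_set UNIV)) {..<CARD('n)} (UNIV :: 'n::{finite,wellorder} set)"
  by (rule bij_betw_nth) auto

lemma coord_index_less: "coord_index (j :: 'n::{finite,wellorder}) < CARD('n)"
  using bij_betwE[OF bij_betw_inv_into[OF bij_betw_nth_UNIV]] unfolding coord_index_def by blast

lemma nth_coord_index: "sorted_list_of_set UNIV ! coord_index j = (j :: 'n::{finite,wellorder})"
  unfolding coord_index_def by (rule bij_betw_inv_into_right[OF bij_betw_nth_UNIV]) simp

lemma coord_index_nth: "k < CARD('n) \<Longrightarrow>
    coord_index (sorted_list_of_set UNIV ! k :: 'n::{finite,wellorder}) = k"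
  unfolding coord_index_def by (rule bij_betw_inv_into_left[OF bij_betw_nth_UNIV]) simp

text \<open>An environment of scalars is cut into consecutive blocks of \<open>n\<close> coordinates, the values of
  vector variables.\<close>

definition blocks :: "(nat \<Rightarrow> real) \<Rightarrow> nat \<Rightarrow> real^'n::{finite,wellorder}" where
  "blocks e b = (\<chi> j. e (b * CARD('n) + coord_index j))"

text \<open>Here \<open>w b\<close> is a variable ranging over vectors. Conditions on vertices can
  then be written without coordinates, and closure under connectives is inherited from scalar
  environments.\<close>

definition vec_definable ::
    "('f, 'r) expansion \<Rightarrow> ((nat \<Rightarrow> real^'n::{finite,wellorder}) \<Rightarrow> bool) \<Rightarrow> bool" where
  "vec_definable R Q \<longleftrightarrow> fo_definable R (\<lambda>e. Q (blocks e))"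

lemma vec_definable_not: "vec_definable R Q \<Longrightarrow> vec_definable R (\<lambda>w. \<not> Q w)"
  unfolding vec_definable_def by (rule fo_definable_not)

lemma vec_definable_conj:
  "vec_definable R P \<Longrightarrow> vec_definable R Q \<Longrightarrow> vec_definable R (\<lambda>w. P w \<and> Q w)"
  unfolding vec_definable_def by (rule fo_definable_conj)

lemma vec_definable_disj:
  assumes "vec_definable R P" "vec_definable R Q"
  shows "vec_definable R (\<lambda>w. P w \<or> Q w)"
proof -
  have "vec_definable R (\<lambda>w. \<not> (\<not> P w \<and> \<not> Q w))"
    using assms by (intro vec_definable_not vec_definable_conj)
  then show ?thesis by simp
qed

lemma vec_definable_imp:
  assumes "vec_definable R P" "vec_definable R Q"
  shows "vec_definable R (\<lambda>w. P w \<longrightarrow> Q w)"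
  using vec_definable_disj[OF vec_definable_not[OF assms(1)] assms(2)] by simp

lemma vec_definable_iff:
  assumes "vec_definable R P" "vec_definable R Q"
  shows "vec_definable R (\<lambda>w. P w \<longleftrightarrow> Q w)"
proof -
  have "vec_definable R (\<lambda>w. (P w \<longrightarrow> Q w) \<and> (Q w \<longrightarrow> P w))"
    using assms by (intro vec_definable_conj vec_definable_imp)
  then show ?thesis by (rule back_subst[where P = "vec_definable R"]) auto
qed

lemma vec_definable_const: "vec_definable R (\<lambda>w. b)"
  unfolding vec_definable_def by (rule fo_definable_const)

lemma vec_definable_ball:
  "finite I \<Longrightarrow> (\<And>i. i \<in> I \<Longrightarrow> vec_definable R (P i)) \<Longrightarrow> vec_definable R (\<lambda>w. \<forall>i\<in>I. P i w)"
  unfolding vec_definable_def by (rule fo_definable_ball)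

lemma vec_definable_bex:
  assumes "finite I" "\<And>i. i \<in> I \<Longrightarrow> vec_definable R (P i)"
  shows "vec_definable R (\<lambda>w. \<exists>i\<in>I. P i w)"
proof -
  have "vec_definable R (\<lambda>w. \<not> (\<forall>i\<in>I. \<not> P i w))"
    using assms by (intro vec_definable_not vec_definable_ball)
  then show ?thesis by simp
qed

text \<open>One vector quantifier is a run of scalar quantifiers over the indices \<open>?K\<close>
  of block \<open>b\<close>; the other blocks are untouched because blocks are disjoint.\<close>

lemma vec_definable_ex:
  fixes Q :: "(nat \<Rightarrow> real^'n::{finite,wellorder}) \<Rightarrow> bool"
  assumes "vec_definable R Q"
  shows "vec_definable R (\<lambda>w. \<exists>x. Q (w(b := x)))"
proof -
  let ?n = "CARD('n)"
  let ?K = "{b * ?n..<b * ?n + ?n}"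
  have blocks: "blocks (\<lambda>k. if k \<in> ?K then f k else e k) =
      (blocks e)(b := \<chi> j :: 'n. f (b * ?n + coord_index j))" for e f
  proof (intro ext)
    fix c
    have "c * ?n + coord_index j \<in> ?K \<longleftrightarrow> c = b" for j :: 'n
    proof
      assume "c * ?n + coord_index j \<in> ?K"
      moreover have "(c * ?n + coord_index j) div ?n = c"
        using coord_index_less[of j] by simp
      ultimately show "c = b"
        by (metis atLeastLessThan_iff div_nat_eqI mult.commute mult_Suc_right add.commute)
    qed (use coord_index_less[of j] in simp)
    then show "(blocks (\<lambda>k. if k \<in> ?K then f k else e k) c :: real^'n::_) =
        ((blocks e)(b := \<chi> j :: 'n. f (b * ?n + coord_index j))) c"
      by (auto simp: blocks_def vec_eq_iff)
  qed
  have "fo_definable R (\<lambda>e. \<exists>f. Q (blocks (\<lambda>k. if k \<in> ?K then f k else e k)))"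
    using assms unfolding vec_definable_def by (intro fo_definable_ex_vars) auto
  then show ?thesis
    unfolding vec_definable_def
  proof (rule fo_definable_cong)
    fix e
    show "(\<exists>f. Q (blocks (\<lambda>k. if k \<in> ?K then f k else e k))) \<longleftrightarrow> (\<exists>x. Q ((blocks e)(b := x)))"
    proof
      assume "\<exists>x. Q ((blocks e)(b := x))"
      then obtain x where x: "Q ((blocks e)(b := x))" ..
      have "(\<chi> j. x $ (sorted_list_of_set UNIV ! (b * ?n + coord_index j - b * ?n))) = x"
        by (simp add: vec_eq_iff nth_coord_index)
      with x show "\<exists>f. Q (blocks (\<lambda>k. if k \<in> ?K then f k else e k))"
        unfolding blocks
        \<comment> \<open>Subtracting the offset of the block turns a scalar index back into the
          position of a coordinate of \<open>x\<close>.\<close>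
        by (intro exI[of _ "\<lambda>k. x $ (sorted_list_of_set UNIV ! (k - b * ?n))"]) simp
    qed (unfold blocks, blast)
  qed
qed

lemma vec_definable_rename:
  fixes Q :: "(nat \<Rightarrow> real^'n::{finite,wellorder}) \<Rightarrow> bool"
  assumes "vec_definable R Q"
  shows "vec_definable R (\<lambda>w. Q (\<lambda>b. w (r b)))"
proof -
  let ?n = "CARD('n)"
  have "fo_definable R (\<lambda>e. Q (blocks (\<lambda>k. term_val R e (Var (r (k div ?n) * ?n + k mod ?n)))))"
    by (rule fo_definable_subst[OF assms[unfolded vec_definable_def],
          where t = "\<lambda>k. Var (r (k div ?n) * ?n + k mod ?n)"])
  moreover have "blocks (\<lambda>k. e (r (k div ?n) * ?n + k mod ?n)) = (\<lambda>b. blocks e (r b) :: real^'n::_)" for e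
    by (auto simp: blocks_def fun_eq_iff vec_eq_iff coord_index_less)
  ultimately show ?thesis
    unfolding vec_definable_def by simp
qed

lemma vec_definable_box:
  fixes u v :: "real^'n::{finite,wellorder}"
  shows "vec_definable R (\<lambda>w. w a \<in> box u v)"
proof -
  let ?x = "\<lambda>j::'n. Var (a * CARD('n) + coord_index j)"
  have "fo_definable R (\<lambda>e. \<forall>j\<in>UNIV. term_val R e (Const (u $ j)) < term_val R e (?x j) \<and>
      term_val R e (?x j) < term_val R e (Const (v $ j)))"
    by (intro fo_definable_ball fo_definable_conj fo_definable_less) simp
  then show ?thesis
    unfolding vec_definable_def by (simp add: mem_box_cart blocks_def)
qed

lemma vec_definable_eq:
  "vec_definable R (\<lambda>w. w a = (w b :: real^'n::{finite,wellorder}))"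
proof -
  have "fo_definable R (\<lambda>e. \<forall>j\<in>UNIV. term_val R e (Var (a * CARD('n) + coord_index (j :: 'n))) =
      term_val R e (Var (b * CARD('n) + coord_index j)))"
    by (intro fo_definable_ball fo_definable_eq) simp
  then show ?thesis
    unfolding vec_definable_def by (simp add: blocks_def vec_eq_iff)
qed

lemma vec_definable_eq_const:
  "vec_definable R (\<lambda>w. w a = (c :: real^'n::{finite,wellorder}))"
proof -
  have "fo_definable R (\<lambda>e. \<forall>j\<in>UNIV. term_val R e (Var (a * CARD('n) + coord_index (j :: 'n))) =
      term_val R e (Const (c $ j)))"
    by (intro fo_definable_ball fo_definable_eq) simp
  then show ?thesis
    unfolding vec_definable_def by (simp add: blocks_def vec_eq_iff)
qed

lemma blocks_coords: "blocks (coords x) 0 = x"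
  by (simp add: blocks_def coords_def coord_index_less nth_coord_index)

lemma inj_coords: "inj coords"
  by (rule inj_on_inverseI[where g = "\<lambda>e. blocks e 0"]) (rule blocks_coords)

lemma coords_blocks: "coords (blocks e 0 :: real^'n::{finite,wellorder}) = restrict e {..<CARD('n)}"
  by (auto simp: blocks_def coords_def coord_index_nth)

lemma blocks_coords2: "blocks (coords2 (x, y)) 0 = x" "blocks (coords2 (x, y)) 1 = y"
proof -
  show "blocks (coords2 (x, y)) 0 = x"
    using coord_index_less[where 'n = 'a]
    by (simp add: blocks_def coords2_def coords_def nth_coord_index trans_less_add1 mult_2)
  have "CARD('a) + coord_index j < 2 * CARD('a)" for j :: 'a
    using coord_index_less[of j] by simp
  then show "blocks (coords2 (x, y)) 1 = y"
    by (auto simp: blocks_def coords2_def coords_def nth_coord_index coord_index_less)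
qed

lemma coords2_blocks:
  "coords2 (blocks e 0, blocks e 1 :: real^'n::{finite,wellorder}) = restrict e {..<2 * CARD('n)}"
  by (auto simp: blocks_def coords2_def coords_def coord_index_nth fun_eq_iff)

lemma inj_coords2: "inj (coords2 :: (real^'n::{finite,wellorder}) \<times> (real^'n::_) \<Rightarrow> nat \<Rightarrow> real)"
proof (rule injI)
  fix p q :: "(real^'n::_) \<times> (real^'n::_)" assume "coords2 p = coords2 q"
  then show "p = q"
    by (metis blocks_coords2 prod.collapse)
qed

lemma vdefinable_iff:
  fixes X :: "(real^'n::{finite,wellorder}) set"
  shows "vdefinable R X \<longleftrightarrow> vec_definable R (\<lambda>w. w 0 \<in> X)"
proof -
  have "coords ` X \<subseteq> rspace CARD('n)"
    unfolding rspace_def PiE_def coords_def by (intro image_subsetI) (simp del: restrict_apply)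
  moreover have "restrict e {..<CARD('n)} \<in> coords ` X \<longleftrightarrow> blocks e 0 \<in> X" for e
    using inj_image_mem_iff[OF inj_coords, of "blocks e 0" X] by (simp only: coords_blocks)
  ultimately show ?thesis
    unfolding vdefinable_def definable_iff vec_definable_def by simp
qed

lemma vdefinable2_iff:
  fixes E :: "((real^'n::{finite,wellorder}) \<times> (real^'n::_)) set"
  shows "vdefinable2 R E \<longleftrightarrow> vec_definable R (\<lambda>w. (w 0, w 1) \<in> E)"
proof -
  have "coords2 ` E \<subseteq> rspace (2 * CARD('n))"
    unfolding rspace_def PiE_def coords2_def by (intro image_subsetI) (simp del: restrict_apply)
  moreover have "restrict e {..<2 * CARD('n)} \<in> coords2 ` E \<longleftrightarrow> (blocks e 0, blocks e 1) \<in> E" for e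
    using inj_image_mem_iff[OF inj_coords2, of "(blocks e 0, blocks e 1)" E]
    by (simp only: coords2_blocks)
  ultimately show ?thesis
    unfolding vdefinable2_def definable_iff vec_definable_def by simp
qed

lemma vec_definable_mem: "vdefinable R X \<Longrightarrow> vec_definable R (\<lambda>w. w a \<in> X)"
  unfolding vdefinable_iff by (drule vec_definable_rename[where r = "\<lambda>_. a"]) simp

lemma vec_definable_mem2:
  assumes "vdefinable2 R E"
  shows "vec_definable R (\<lambda>w. (w a, w b) \<in> E)"
  using vec_definable_rename[OF assms[unfolded vdefinable2_iff], of "\<lambda>i. if i = 0 then a else b"]
  by simp

section \<open>Definable maps\<close>

text \<open>Maps are total, a partial map being extended by \<open>undefined\<close>. Compositions
  and preimages then carry no side conditions on domains.\<close>

definition definable_map ::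
    "('f, 'r) expansion \<Rightarrow> (real^'n::{finite,wellorder} \<Rightarrow> real^'n::_) \<Rightarrow> bool" where
  "definable_map R g \<longleftrightarrow> vec_definable R (\<lambda>w. w 1 = g (w 0))"

lemma vec_definable_eq_map:
  assumes "definable_map R g"
  shows "vec_definable R (\<lambda>w. w b = g (w a))"
  using vec_definable_rename[OF assms[unfolded definable_map_def], of "\<lambda>i. if i = 0 then a else b"]
  by simp

text \<open>Plugging in \<open>g (w a)\<close> means quantifying over block \<open>b\<close> subject
  to \<open>w b = g (w a)\<close>; \<open>a \<noteq> b\<close> keeps the quantifier from overwriting
  the argument.\<close>

lemma vec_definable_subst_map:
  assumes "vec_definable R Q" "definable_map R g" "a \<noteq> b"
  shows "vec_definable R (\<lambda>w. Q (w(b := g (w a))))"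
proof -
  have "vec_definable R (\<lambda>w. w b = g (w a) \<and> Q w)"
    using assms by (intro vec_definable_conj vec_definable_eq_map)
  from vec_definable_ex[OF this, of b] show ?thesis
    using assms(3) by simp
qed

lemma definable_map_id: "definable_map R (\<lambda>x. x)"
  unfolding definable_map_def by (rule vec_definable_eq)

lemma definable_map_comp:
  assumes "definable_map R f" "definable_map R g"
  shows "definable_map R (\<lambda>x. g (f x))"
  using vec_definable_subst_map[OF vec_definable_eq_map[OF assms(2), of 1 2] assms(1), of 0 2]
  by (simp add: definable_map_def)

lemma vec_definable_vimage:
  assumes "vdefinable R X" "definable_map R f"
  shows "vec_definable R (\<lambda>w. f (w a) \<in> X)"
  using vec_definable_subst_map[OF vec_definable_mem[OF assms(1), of "Suc a"] assms(2), of a "Suc a"]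
  by simp

lemma vec_definable_vimage2:
  assumes "vdefinable2 R E" "definable_map R f" "definable_map R g"
  shows "vec_definable R (\<lambda>w. (f (w a), g (w a)) \<in> E)"
  using vec_definable_subst_map[OF vec_definable_subst_map[OF
      vec_definable_mem2[OF assms(1), of "Suc a" "Suc (Suc a)"] assms(2), of a "Suc a"]
      assms(3), of a "Suc (Suc a)"]
  by simp

lemma vec_definable_maps_eq:
  assumes "definable_map R f" "definable_map R g"
  shows "vec_definable R (\<lambda>w. f (w a) = g (w a))"
  using vec_definable_subst_map[OF vec_definable_eq_map[OF assms(2), of "Suc a" a] assms(1), of a "Suc a"]
  by simp

lemma vdefinable_image:
  assumes "vdefinable R D" "definable_map R f"
  shows "vdefinable R (f ` D)"
proof -
  have "vec_definable R (\<lambda>w. w 1 \<in> D \<and> w 0 = f (w 1))"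
    using assms by (intro vec_definable_conj vec_definable_mem vec_definable_eq_map)
  from vec_definable_ex[OF this, of 1] have "vec_definable R (\<lambda>w. \<exists>x. x \<in> D \<and> w 0 = f x)"
    by simp
  then show ?thesis
    unfolding vdefinable_iff by (simp add: image_iff Bex_def)
qed

lemma vdefinable_covered:
  assumes "vdefinable2 R M"
  shows "vdefinable R (covered M)"
proof -
  have "vec_definable R (\<lambda>w. (w 0, w 1) \<in> M \<or> (w 1, w 0) \<in> M)"
    using assms by (intro vec_definable_disj vec_definable_mem2)
  from vec_definable_ex[OF this, of 1] have "vec_definable R (\<lambda>w. \<exists>y. (w 0, y) \<in> M \<or> (y, w 0) \<in> M)"
    by simp
  moreover have "x \<in> covered M \<longleftrightarrow> (\<exists>y. (x, y) \<in> M \<or> (y, x) \<in> M)" for x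
    by (force simp: covered_def)
  ultimately show ?thesis
    unfolding vdefinable_iff by simp
qed

lemma vdefinable_Union:
  assumes "finite \<D>" "\<And>X. X \<in> \<D> \<Longrightarrow> vdefinable R X"
  shows "vdefinable R (\<Union>\<D>)"
  using vec_definable_bex[of \<D> R "\<lambda>X w. w 0 \<in> X"] assms by (simp add: vdefinable_iff)

text \<open>Outside \<open>X\<close> the map takes the constant value \<open>undefined\<close>,
  which is available as a parameter, so the graph over \<open>X\<close> determines a definable total
  graph.\<close>

lemma definable_map_extensional:
  assumes X: "vdefinable R X" and f: "f \<in> extensional X" and graph: "vdefinable2 R (graph_on X f)"
  shows "definable_map R f"
proof -
  have "vec_definable R (\<lambda>w. (w 0, w 1) \<in> graph_on X f \<or> \<not> w 0 \<in> X \<and> w 1 = undefined)"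
    using assms by (intro vec_definable_disj vec_definable_conj vec_definable_not vec_definable_mem2
        vec_definable_mem vec_definable_eq_const)
  moreover have "w 1 = f (w 0) \<longleftrightarrow> (w 0, w 1) \<in> graph_on X f \<or> \<not> w 0 \<in> X \<and> w 1 = undefined"
    for w :: "nat \<Rightarrow> _"
    using f by (auto simp: graph_on_def extensional_def)
  ultimately show ?thesis
    unfolding definable_map_def by (simp only:)
qed

lemma definable_map_inverse:
  assumes X: "vdefinable R X" and Y: "vdefinable R Y" and f: "definable_map R f"
    and inj: "inj_on f X" and sub: "Y \<subseteq> f ` X"
  shows "definable_map R (restrict (inv_into X f) Y)"
proof -
  have "vec_definable R (\<lambda>w. w 0 \<in> Y \<and> w 1 \<in> X \<and> w 0 = f (w 1) \<or> \<not> w 0 \<in> Y \<and> w 1 = undefined)"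
    using assms by (intro vec_definable_disj vec_definable_conj vec_definable_not vec_definable_eq_map
        vec_definable_mem vec_definable_eq_const)
  moreover have "w 1 = restrict (inv_into X f) Y (w 0) \<longleftrightarrow>
      w 0 \<in> Y \<and> w 1 \<in> X \<and> w 0 = f (w 1) \<or> \<not> w 0 \<in> Y \<and> w 1 = undefined"
    for w :: "nat \<Rightarrow> _"
    using sub by (auto simp: inv_into_f_f[OF inj] f_inv_into_f inv_into_into)
  ultimately show ?thesis
    unfolding definable_map_def by (simp only:)
qed

section \<open>Exchanging edges along disjoint augmenting paths\<close>

text \<open>The bijection is replaced by uniqueness of partners on either side, a form that can be
  checked edge by edge after an exchange.\<close>

lemma matching_iff:
  "matching A B G M \<longleftrightarrow> M \<subseteq> G \<and> M \<subseteq> A \<times> B \<and>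
    (\<forall>a b b'. (a, b) \<in> M \<longrightarrow> (a, b') \<in> M \<longrightarrow> b = b') \<and>
    (\<forall>a a' b. (a, b) \<in> M \<longrightarrow> (a', b) \<in> M \<longrightarrow> a = a')"
    (is "_ \<longleftrightarrow> ?R")
proof
  assume "matching A B G M"
  then obtain X Y f where "M \<subseteq> G" and f: "X \<subseteq> A" "Y \<subseteq> B" "bij_betw f X Y" "M = graph_on X f"
    unfolding matching_def by blast
  moreover have "f ` X = Y" "inj_on f X"
    using f by (auto simp: bij_betw_def)
  ultimately show ?R
    by (auto simp: graph_on_def inj_on_def)
next
  assume R: ?R
  then have sub: "M \<subseteq> G" "M \<subseteq> A \<times> B" by (rule conjunct1, elim conjE)
  define f where "f a = (THE b. (a, b) \<in> M)" for a
  have f: "f (fst e) = snd e" if "e \<in> M" for e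
  proof -
    have "(fst e, snd e) \<in> M" using that by simp
    then show ?thesis unfolding f_def using R by blast
  qed
  have "bij_betw f (fst ` M) (snd ` M)"
    unfolding bij_betw_def
  proof
    show "inj_on f (fst ` M)"
    proof (rule inj_onI)
      fix a a' assume "a \<in> fst ` M" "a' \<in> fst ` M" and eq: "f a = f a'"
      then obtain b b' where e: "(a, b) \<in> M" "(a', b') \<in> M" by auto
      then have "b = b'" using f[OF e(1)] f[OF e(2)] eq by simp
      then show "a = a'" using R e by blast
    qed
    show "f ` fst ` M = snd ` M"
      unfolding image_image using f by (intro image_cong) auto
  qed
  moreover have "M = graph_on (fst ` M) f"
  proof -
    have "graph_on (fst ` M) f = (\<lambda>e. e) ` M"
      unfolding graph_on_def image_image by (intro image_cong) (auto simp: f)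
    then show ?thesis by simp
  qed
  moreover have "fst ` M \<subseteq> A" "snd ` M \<subseteq> B"
    using sub(2) by auto
  ultimately show "matching A B G M"
    unfolding matching_def using sub(1) by blast
qed

lemma covered_matching_subset:
  assumes "matching A B G M"
  shows "covered M \<subseteq> A \<union> B"
proof -
  have "M \<subseteq> A \<times> B" using assms by (simp add: matching_iff)
  then show ?thesis by (auto simp: covered_def)
qed

definition orbit :: "(nat \<Rightarrow> 'a \<Rightarrow> 'a) \<Rightarrow> nat \<Rightarrow> 'a \<Rightarrow> 'a list" where
  "orbit h l x = map (\<lambda>i. h i x) [0..<Suc l]"

lemma orbit_simps:
  "length (orbit h l x) = Suc l" "path_length (orbit h l x) = l"
  "i \<le> l \<Longrightarrow> orbit h l x ! i = h i x" "hd (orbit h l x) = h 0 x" "last (orbit h l x) = h l x"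
  by (auto simp: orbit_def path_length_def hd_map last_map simp del: upt_Suc)

text \<open>The last edge cannot lie in \<open>M\<close>, since it would cover the last vertex.
  Edges in \<open>M\<close> are exactly those of odd index, so the last index is even and the length
  is its successor.\<close>

lemma augmenting_path_odd_length:
  assumes "augmenting_path G M p"
  shows "odd (path_length p)"
proof -
  have "2 \<le> length p" "p \<noteq> []"
    using assms by (auto simp: augmenting_path_def is_path_def)
  then obtain m where m: "path_length p = Suc m" "last p = p ! Suc m"
    by (cases "length p - 1") (auto simp: path_length_def last_conv_nth)
  have "(p ! m, p ! Suc m) \<notin> M \<union> M\<inverse>"
  proof
    assume "(p ! m, p ! Suc m) \<in> M \<union> M\<inverse>"
    then have "last p \<in> covered M"
      unfolding covered_def m(2) by force
    then show False
      using assms by (simp add: augmenting_path_def)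
  qed
  then show ?thesis
    using assms m(1) by (auto simp: augmenting_path_def)
qed

text \<open>Position of the vertex joined to the \<open>i\<close>-th one by the even edges of a path of odd length.\<close>

definition mate :: "nat \<Rightarrow> nat" where
  "mate i = (if even i then Suc i else i - 1)"

text \<open>Symmetric difference of \<open>M\<close> with all orbits starting in \<open>D\<close> at
  once, described by vertices: edges of \<open>M\<close> touching an orbit vertex go, and the even
  edges come in. Each even edge arises from both of its ends; the restriction to
  \<open>A \<times> B\<close> keeps one orientation.\<close>

definition exchange ::
    "'a set \<Rightarrow> 'a set \<Rightarrow> (nat \<Rightarrow> 'a \<Rightarrow> 'a) \<Rightarrow> nat \<Rightarrow> 'a set \<Rightarrow> ('a \<times> 'a) set \<Rightarrow> ('a \<times> 'a) set" where
  "exchange A B h l D M =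
    M \<inter> (- (\<Union>i\<le>l. h i ` D)) \<times> (- (\<Union>i\<le>l. h i ` D)) \<union>
    {(u, v) \<in> A \<times> B. \<exists>i\<in>{..l}. \<exists>x\<in>D. u = h i x \<and> v = h (mate i) x}"

text \<open>The set \<open>V\<close> of orbit vertices is closed under partners in \<open>M\<close>:
  interior vertices are matched along odd edges, and end vertices are uncovered. So removing the
  edges at \<open>V\<close> strands no vertex outside \<open>V\<close>, while \<open>mate\<close>
  pairs up \<open>V\<close> anew. The injectivity hypothesis makes this pairing unambiguous within
  an orbit and across orbits.\<close>

lemma exchange_augments:
  assumes AB: "A \<inter> B = {}" "G \<subseteq> A \<times> B \<union> B \<times> A" "sym G" and M: "matching A B G M"
    and h0: "\<And>x. h 0 x = x"
    and aug: "\<And>x. x \<in> D \<Longrightarrow> augmenting_path G M (orbit h l x)"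
    and inj: "\<And>x y i j. x \<in> D \<Longrightarrow> y \<in> D \<Longrightarrow> i \<le> l \<Longrightarrow> j \<le> l \<Longrightarrow> h i x = h j y \<Longrightarrow> i = j \<and> x = y"
  shows "matching A B G (exchange A B h l D M)"
    and "covered M \<union> D \<subseteq> covered (exchange A B h l D M)"
proof -
  let ?W = "M \<union> M\<inverse>"
  define V where "V = (\<Union>i\<le>l. h i ` D)"
  define N where "N = exchange A B h l D M"
  have N: "(u, v) \<in> N \<longleftrightarrow> (u, v) \<in> M \<and> u \<notin> V \<and> v \<notin> V \<or>
      u \<in> A \<and> v \<in> B \<and> (\<exists>i\<le>l. \<exists>x\<in>D. u = h i x \<and> v = h (mate i) x)" for u v
    unfolding N_def exchange_def V_def[symmetric] by auto
  have V: "v \<in> V \<longleftrightarrow> (\<exists>i\<le>l. \<exists>x\<in>D. v = h i x)" for v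
    unfolding V_def by auto
  have M_G: "M \<subseteq> G" "M \<subseteq> A \<times> B"
    using M by (simp_all add: matching_iff)
  \<comment> \<open>As \<open>A\<close> and \<open>B\<close> are disjoint, no vertex is a first
    component of one edge of \<open>M\<close> and a second component of another, so partners stay
    unique after symmetrizing.\<close>
  have W_unique: "v = v'" if "(u, v) \<in> ?W" "(u, v') \<in> ?W" for u v v'
    using that M AB(1) M_G(2) unfolding matching_iff by blast
  have covered: "u \<in> covered E \<longleftrightarrow> (\<exists>v. (u, v) \<in> E \<union> E\<inverse>)" for u :: 'a and E
    unfolding covered_def by force
  have edge: "(h i x, h (Suc i) x) \<in> G" "(h i x, h (Suc i) x) \<in> ?W \<longleftrightarrow> odd i" if "x \<in> D" "i < l" for x i
    using aug[OF that(1)] that(2) by (auto simp: augmenting_path_def is_path_def orbit_simps)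
  have ends: "h 0 x \<notin> covered M" "h l x \<notin> covered M" if "x \<in> D" for x
    using aug[OF that] by (auto simp: augmenting_path_def orbit_simps)
  have odd_l: "odd l" if "x \<in> D" for x
    using augmenting_path_odd_length[OF aug[OF that]] by (simp add: orbit_simps)
  have mate: "mate i \<le> l \<and> mate (mate i) = i \<and> (h i x, h (mate i) x) \<in> G" if "x \<in> D" "i \<le> l" for x i
  proof (cases "even i")
    case True
    \<comment> \<open>An even position differs from the odd \<open>l\<close>, so its mate is still a
      position on the path.\<close>
    with odd_l[OF that(1)] that(2) have "i < l" by (metis le_neq_implies_less)
    then show ?thesis using True edge(1)[OF that(1)] by (simp add: mate_def)
  next
    case False
    then obtain m where "i = Suc m" "even m" by (cases i) auto
    then show ?thesis using edge(1)[OF that(1), of m] that(2) symD[OF AB(3)] by (auto simp: mate_def)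
  qed
  have closed: "v \<in> V" if u: "u \<in> V" and "(u, v) \<in> ?W" for u v
  proof -
    obtain i x where x: "i \<le> l" "x \<in> D" "u = h i x" using u unfolding V by blast
    have "u \<in> covered M" using \<open>(u, v) \<in> ?W\<close> unfolding covered by blast
    then have "i \<noteq> 0" "i \<noteq> l" using ends[OF x(2)] x(3) by metis+
    then have i: "i \<noteq> 0" "i < l" using x(1) by simp_all
    show ?thesis
    proof (cases "even i")
      case True
      then obtain m where m: "i = Suc m" "odd m" using i by (cases i) auto
      then have "(u, h m x) \<in> ?W" using edge(2)[OF x(2), of m] i x by auto
      then have "v = h m x" using \<open>(u, v) \<in> ?W\<close> W_unique by blast
      then show ?thesis unfolding V using m x by (intro exI[of _ m]) auto
    next
      case False
      then have "(u, h (Suc i) x) \<in> ?W" using edge(2)[OF x(2) i(2)] x by auto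
      then have "v = h (Suc i) x" using \<open>(u, v) \<in> ?W\<close> W_unique by blast
      then show ?thesis unfolding V using i x by (intro exI[of _ "Suc i"]) auto
    qed
  qed
  have new_mem: "(u, v) \<in> N \<union> N\<inverse> \<and> v \<in> V" if "i \<le> l" "x \<in> D" "u = h i x" "v = h (mate i) x" for u v i x
  proof -
    note m = mate[OF that(2,1)]
    have "v \<in> V" unfolding V using that m by blast
    moreover have "u \<in> A \<and> v \<in> B \<or> u \<in> B \<and> v \<in> A" using m AB(2) that by blast
    moreover have "u = h (mate (mate i)) x" using m that by simp
    ultimately show ?thesis unfolding N Un_iff converse_iff using that m by blast
  qed
  have V_N: "u \<in> V \<and> v \<in> V" if "(u, v) \<in> N" "u \<in> V \<or> v \<in> V" for u v
    using that new_mem unfolding N by (metis V)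
  have unique1: "v = v'" if "(u, v) \<in> N" "(u, v') \<in> N" for u v v'
  proof (cases "u \<in> V")
    case True
    then obtain i x i' x' where "i \<le> l" "x \<in> D" "u = h i x" "v = h (mate i) x"
      "i' \<le> l" "x' \<in> D" "u = h i' x'" "v' = h (mate i') x'"
      using \<open>(u, v) \<in> N\<close> \<open>(u, v') \<in> N\<close> unfolding N by auto
    then show ?thesis using inj[of x x' i i'] by auto
  next
    case False
    with that have "(u, v) \<in> M" "(u, v') \<in> M" unfolding N by (auto simp: V)
    then show ?thesis using M unfolding matching_iff by blast
  qed
  have unique2: "u = u'" if "(u, v) \<in> N" "(u', v) \<in> N" for u u' v
  proof (cases "v \<in> V")
    case True
    then obtain i x i' x' where *: "i \<le> l" "x \<in> D" "u = h i x" "v = h (mate i) x"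
      "i' \<le> l" "x' \<in> D" "u' = h i' x'" "v = h (mate i') x'"
      using \<open>(u, v) \<in> N\<close> \<open>(u', v) \<in> N\<close> unfolding N by auto
    \<comment> \<open>Injectivity identifies the positions of the common partner; the involution
      \<open>mate\<close> then gives \<open>i = i'\<close>.\<close>
    then have "mate i = mate i' \<and> x = x'"
      using inj[of x x' "mate i" "mate i'"] mate by auto
    then have "i = i'" "x = x'" using mate[of x i] mate[of x' i'] * by metis+
    then show ?thesis using * by simp
  next
    case False
    with that V_N have "(u, v) \<in> M" "(u', v) \<in> M" unfolding N using new_mem by blast+
    then show ?thesis using M unfolding matching_iff by blast
  qed
  have "N \<subseteq> G \<inter> A \<times> B"
  proof
    fix e assume "e \<in> N"
    moreover obtain u v where "e = (u, v)" by (cases e)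
    ultimately show "e \<in> G \<inter> A \<times> B" using M_G mate N by blast
  qed
  then show "matching A B G (exchange A B h l D M)"
    unfolding matching_iff N_def[symmetric] using unique1 unique2 by blast
  show "covered M \<union> D \<subseteq> covered (exchange A B h l D M)"
    unfolding N_def[symmetric]
  proof
    fix u assume u: "u \<in> covered M \<union> D"
    show "u \<in> covered N"
    proof (cases "u \<in> V")
      case True
      then show ?thesis using new_mem unfolding V covered by blast
    next
      case False
      have "D \<subseteq> V" using h0 V by (metis le0 subsetI)
      with u False obtain v where v: "(u, v) \<in> ?W" unfolding Un_iff covered by blast
      with closed[of v u] False have "v \<notin> V" by blast
      with v False have "(u, v) \<in> N \<union> N\<inverse>" unfolding Un_iff converse_iff N by blast
      then show ?thesis unfolding covered by blast
    qed
  qed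
qed

section \<open>The maps along generic paths\<close>

primrec path_map :: "('a \<Rightarrow> 'a) list \<Rightarrow> nat \<Rightarrow> 'a \<Rightarrow> 'a" where
  "path_map s 0 x = x"
| "path_map s (Suc i) x = (s ! i) (path_map s i x)"

lemma generating_sequence_nth:
  assumes "generating_sequence A Cs Fs p s" "i \<le> length s"
  shows "p ! i = path_map s i (p ! 0)"
  using assms(2)
proof (induction i)
  case (Suc i)
  then have "p ! Suc i = (s ! i) (p ! i)"
    using assms(1) unfolding generating_sequence_def by (metis Suc_le_eq)
  then show ?case using Suc by simp
qed simp

lemma generating_sequence_orbit:
  assumes "generating_sequence A Cs Fs p s" "p \<noteq> []"
  shows "p = orbit (path_map s) (length s) (hd p)"
proof (rule nth_equalityI)
  show len: "length p = length (orbit (path_map s) (length s) (hd p))"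
    using assms by (simp add: orbit_simps generating_sequence_def path_length_def)
  fix i assume "i < length p"
  then show "p ! i = orbit (path_map s) (length s) (hd p) ! i"
    using generating_sequence_nth[OF assms(1), of i] len assms(2) by (simp add: orbit_simps hd_conv_nth)
qed

lemma C1_on_continuous_on: "C1_on U f \<Longrightarrow> continuous_on U f"
  unfolding C1_on_def by (meson continuous_at_imp_continuous_on has_derivative_continuous)

section \<open>Regularity of the cells and maps in the construction\<close>

lemma path_construction_partition:
  assumes "path_construction R A B G M K \<C> Cs Fs" "1 \<le> j" "j \<le> 2 * K + 2"
  shows "\<exists>X. open_partition R X (Cs j)"
proof -
  obtain i where "j = Suc i" using assms by (cases j) auto
  then have "open_partition R (if even i then B else A) (Cs j)"
    using assms(1,3) unfolding path_construction_def by (metis Suc_le_lessD)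
  then show ?thesis ..
qed

text \<open>The open partitions in the construction begin at stage 1. At stage 0 finiteness comes
  from the decomposition of the doubled space, whose members are projected to give
  \<open>Cs 0\<close>.\<close>

lemma path_construction_finite:
  fixes Cs :: "nat \<Rightarrow> (real^'n::{finite,wellorder}) set set"
  assumes pc: "path_construction R A B G M K \<C> Cs Fs" and j: "j \<le> 2 * K + 2"
  shows "finite (Cs j)"
proof (cases "j = 0")
  case True
  obtain m where m: "2 * CARD('n) = Suc m" by (cases "2 * CARD('n)") auto
  have "finite ((`) coords2 ` \<C>)"
    using pc unfolding path_construction_def vdecomposition2_def m by simp
  moreover have "inj_on ((`) coords2) \<C>"
    by (intro inj_onI) (simp only: inj_image_eq_iff[OF inj_coords2])
  ultimately have "finite \<C>" by (rule finite_imageD)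
  moreover have "Cs 0 \<subseteq> (`) fst ` \<C>"
    using pc by (auto simp: path_construction_def initial_family_def)
  ultimately show ?thesis using True by (meson finite_imageI finite_subset)
next
  case False
  then show ?thesis
    using path_construction_partition[OF pc, of j] j by (auto simp: open_partition_def)
qed

text \<open>All maps descend from the \<open>n\<close>-isomorphisms of stage 0 by repeated inversion
  and restriction, and the listed properties survive both operations.\<close>

lemma path_construction_maps:
  fixes Cs :: "nat \<Rightarrow> (real^'n::{finite,wellorder}) set set"
  assumes pc: "path_construction R A B G M K \<C> Cs Fs"
    and "i \<le> 2 * K + 2" "X \<in> Cs i" "f \<in> Fs i X"
  shows "open X \<and> vdefinable R X \<and> continuous_on X f \<and> inj_on f X \<and> definable_map R f"
  using assms(2-)
proof (induction i arbitrary: X f)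
  case 0
  then have "f \<in> extensional X" "n_isomorphism R X f"
    using pc by (auto simp: path_construction_def initial_maps_def)
  then show ?case
    by (auto simp: n_isomorphism_def C1_on_continuous_on intro: definable_map_extensional)
next
  case (Suc i)
  then have i: "i < 2 * K + 2" by simp
  have "f \<in> inverse_maps (Cs i) (Fs i) X"
    using pc i Suc.prems(2,3) by (auto simp: path_construction_def)
  then obtain X' f' where f': "X' \<in> Cs i" "f' \<in> Fs i X'" "X \<subseteq> f' ` X'"
    and f: "f = restrict (inv_into X' f') X"
    unfolding inverse_maps_def by blast
  have IH: "open X'" "vdefinable R X'" "continuous_on X' f'" "inj_on f' X'" "definable_map R f'"
    using Suc.IH[OF _ f'(1,2)] i by auto
  have X: "open X" "vdefinable R X"
    using path_construction_partition[OF pc, of "Suc i"] i Suc.prems(2)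
    by (auto simp: open_partition_def vcell_vdefinable)
  \<comment> \<open>Invariance of domain: an injective continuous map on an open subset of a
    Euclidean space, into a space of the same dimension, has a continuous inverse.\<close>
  have "continuous_on (f' ` X') (inv_into X' f')"
    using IH by (intro continuous_on_inverse_open) auto
  then have "continuous_on X f"
    unfolding f using f'(3) by (simp add: continuous_on_subset cong: continuous_on_cong)
  moreover have "inj_on f X"
    unfolding f using inj_on_inv_into[OF f'(3)] by (simp cong: inj_on_cong)
  moreover have "definable_map R f"
    unfolding f using IH X f' by (intro definable_map_inverse) auto
  ultimately show ?case using X by blast
qed

text \<open>For \<open>i = j\<close> the path map is a composite of continuous injective maps near
  the start. For \<open>i \<noteq> j\<close> the vertices of \<open>p\<close> at these positions are
  distinct, and disjoint neighbourhoods of them pull back. Finitely many pairs leave an open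
  intersection; a box inside it is definable.\<close>

lemma path_map_locally_injective:
  fixes Cs :: "nat \<Rightarrow> (real^'n::{finite,wellorder}) set set"
  assumes pc: "path_construction R A B G M K \<C> Cs Fs"
    and p: "p \<in> generic_paths A G K Cs" and gen: "generating_sequence A Cs Fs p s"
    and U: "open U" "hd p \<in> U"
  shows "\<exists>a b. hd p \<in> box a b \<and> box a b \<subseteq> U \<and>
    (\<forall>x\<in>box a b. \<forall>y\<in>box a b. \<forall>i\<le>length s. \<forall>j\<le>length s.
      path_map s i x = path_map s j y \<longrightarrow> i = j \<and> x = y)"
proof -
  let ?h = "path_map s" and ?l = "length s" and ?x0 = "hd p"
  have ne: "p \<noteq> []" and dist: "distinct p" and l: "?l \<le> 2 * K + 1" "length p = Suc ?l"
    using p gen by (auto simp: generic_paths_def is_path_def generating_sequence_def path_length_def)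
  have nth: "p ! i = ?h i ?x0" if "i \<le> ?l" for i
    using generating_sequence_nth[OF gen that] ne by (simp add: hd_conv_nth)
  have step: "\<exists>X. open X \<and> ?h i ?x0 \<in> X \<and> continuous_on X (s ! i) \<and> inj_on (s ! i) X" if il: "i < ?l" for i
  proof -
    obtain X where X: "X \<in> Cs (start_index A p + i)" "s ! i \<in> Fs (start_index A p + i) X" "p ! i \<in> X"
      using gen il unfolding generating_sequence_def by metis
    have "start_index A p + i \<le> 2 * K + 2"
      using l that by (simp add: start_index_def)
    from path_construction_maps[OF pc this X(1,2)] show ?thesis
      using X(3) nth[of i] that by auto
  qed
  have nbhd: "\<exists>V. open V \<and> ?x0 \<in> V \<and> continuous_on V (?h i) \<and> inj_on (?h i) V" if "i \<le> ?l" for i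
    using that
  proof (induction i)
    case 0
    show ?case by (rule exI[of _ UNIV]) (simp add: inj_on_def)
  next
    case (Suc i)
    then obtain V where V: "open V" "?x0 \<in> V" "continuous_on V (?h i)" "inj_on (?h i) V" by auto
    obtain X where X: "open X" "?h i ?x0 \<in> X" "continuous_on X (s ! i)" "inj_on (s ! i) X"
      using step[of i] Suc.prems by auto
    let ?V = "V \<inter> ?h i -` X"
    have "open ?V" using V X by (intro continuous_open_preimage)
    moreover have "continuous_on ?V (\<lambda>x. (s ! i) (?h i x))"
      using V X by (intro continuous_on_compose2[OF X(3)]) (auto intro: continuous_on_subset)
    moreover have "inj_on (\<lambda>x. (s ! i) (?h i x)) ?V"
      using V(4) X(4) by (auto simp: inj_on_def)
    ultimately show ?case using V X by (intro exI[of _ ?V]) auto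
  qed
  have "\<exists>V. open V \<and> ?x0 \<in> V \<and> (\<forall>x\<in>V. \<forall>y\<in>V. ?h i x = ?h j y \<longrightarrow> i = j \<and> x = y)"
    if ij: "i \<le> ?l" "j \<le> ?l" for i j
  proof (cases "i = j")
    case True
    then show ?thesis using nbhd[OF ij(1)] by (auto simp: inj_on_def)
  next
    case False
    then have "?h i ?x0 \<noteq> ?h j ?x0"
      using dist ij l nth by (metis distinct_conv_nth le_imp_less_Suc)
    then obtain O1 O2 where O: "open O1" "open O2" "?h i ?x0 \<in> O1" "?h j ?x0 \<in> O2" "O1 \<inter> O2 = {}"
      using hausdorff by metis
    obtain V1 V2 where V: "open V1" "?x0 \<in> V1" "continuous_on V1 (?h i)"
      "open V2" "?x0 \<in> V2" "continuous_on V2 (?h j)"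
      using nbhd[OF ij(1)] nbhd[OF ij(2)] by metis
    let ?V = "(V1 \<inter> ?h i -` O1) \<inter> (V2 \<inter> ?h j -` O2)"
    have "open ?V" using V O by (intro open_Int continuous_open_preimage)
    then show ?thesis using V O by (intro exI[of _ ?V]) auto
  qed
  then obtain V where V: "\<And>i j. i \<le> ?l \<Longrightarrow> j \<le> ?l \<Longrightarrow> open (V i j) \<and> ?x0 \<in> V i j \<and>
      (\<forall>x\<in>V i j. \<forall>y\<in>V i j. ?h i x = ?h j y \<longrightarrow> i = j \<and> x = y)"
    by metis
  have "open (U \<inter> (\<Inter>i\<le>?l. \<Inter>j\<le>?l. V i j))"
    using U(1) V by (intro open_Int open_INT) auto
  moreover have "?x0 \<in> U \<inter> (\<Inter>i\<le>?l. \<Inter>j\<le>?l. V i j)"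
    using U(2) V by auto
  ultimately obtain a b where ab: "?x0 \<in> box a b" "box a b \<subseteq> U \<inter> (\<Inter>i\<le>?l. \<Inter>j\<le>?l. V i j)"
    using open_contains_box by metis
  have "\<forall>x\<in>box a b. \<forall>y\<in>box a b. \<forall>i\<le>?l. \<forall>j\<le>?l. ?h i x = ?h j y \<longrightarrow> i = j \<and> x = y"
  proof (intro ballI allI impI)
    fix x y i j assume *: "x \<in> box a b" "y \<in> box a b" "i \<le> ?l" "j \<le> ?l" "?h i x = ?h j y"
    then have "x \<in> V i j" "y \<in> V i j" using ab(2) by auto
    then show "i = j \<and> x = y" using V[OF *(3,4)] *(5) by blast
  qed
  then show ?thesis using ab by blast
qed

lemma path_map_definable:
  fixes Cs :: "nat \<Rightarrow> (real^'n::{finite,wellorder}) set set"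
  assumes pc: "path_construction R A B G M K \<C> Cs Fs"
    and p: "p \<in> generic_paths A G K Cs" and gen: "generating_sequence A Cs Fs p s"
    and i: "i \<le> length s"
  shows "definable_map R (path_map s i)"
  using i
proof (induction i)
  case 0
  show ?case by (simp add: definable_map_id)
next
  case (Suc i)
  then have i: "i < length s" by simp
  have l: "length s \<le> 2 * K + 1"
    using p gen by (auto simp: generic_paths_def generating_sequence_def)
  obtain X where X: "X \<in> Cs (start_index A p + i)" "s ! i \<in> Fs (start_index A p + i) X"
    using gen i unfolding generating_sequence_def by metis
  have "start_index A p + i \<le> 2 * K + 2"
    using l i by (simp add: start_index_def)
  from path_construction_maps[OF pc this X] have "definable_map R (s ! i)" by blast
  then show ?case
    using definable_map_comp[of R "path_map s i" "s ! i"] Suc by simp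
qed

section \<open>Definability of starting vertices and exchanged matchings\<close>

text \<open>A nonempty path is recovered from its start and its generating sequence. This removes
  the quantifier over paths and leaves a condition on \<open>x\<close> alone.\<close>

lemma mem_starting_vertices:
  assumes "[] \<notin> Q"
  shows "x \<in> starting_vertices A Cs Fs Q s \<longleftrightarrow>
    orbit (path_map s) (length s) x \<in> Q \<and>
    generating_sequence A Cs Fs (orbit (path_map s) (length s) x) s"
proof
  assume "x \<in> starting_vertices A Cs Fs Q s"
  then obtain p where p: "x = hd p" "p \<in> Q" "generating_sequence A Cs Fs p s"
    unfolding starting_vertices_def by blast
  then have "p = orbit (path_map s) (length s) x"
    using generating_sequence_orbit assms by metis
  then show "orbit (path_map s) (length s) x \<in> Q \<and>
      generating_sequence A Cs Fs (orbit (path_map s) (length s) x) s"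
    using p by simp
next
  assume "orbit (path_map s) (length s) x \<in> Q \<and>
      generating_sequence A Cs Fs (orbit (path_map s) (length s) x) s"
  moreover have "x = hd (orbit (path_map s) (length s) x)"
    by (simp add: orbit_simps)
  ultimately show "x \<in> starting_vertices A Cs Fs Q s"
    unfolding starting_vertices_def by blast
qed

text \<open>If no generic path generates \<open>s\<close>, the set is empty. Otherwise such a path
  bounds the length of \<open>s\<close> and makes its path maps definable, and membership is a
  finite Boolean combination of conditions on the vertices \<open>?h i x\<close>. The stage depends
  on the side of the start, hence the split on \<open>x \<in> A\<close> in \<open>T\<close>.\<close>

lemma vdefinable_augmenting_starts:
  fixes Cs :: "nat \<Rightarrow> (real^'n::{finite,wellorder}) set set"
  assumes pc: "path_construction R A B G M K \<C> Cs Fs"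
    and A: "vdefinable R A" and G: "vdefinable2 R G" and N: "vdefinable2 R N"
  shows "vdefinable R (starting_vertices A Cs Fs
      {p \<in> generic_paths A G K Cs. augmenting_path G N p} s)"
    (is "vdefinable R ?T")
proof (cases "\<exists>p\<in>generic_paths A G K Cs. generating_sequence A Cs Fs p s")
  case False
  then have "?T = {}"
    unfolding starting_vertices_def by blast
  then show ?thesis by (simp add: vdefinable_iff vec_definable_const)
next
  case True
  then obtain p where p: "p \<in> generic_paths A G K Cs" "generating_sequence A Cs Fs p s" by blast
  let ?h = "path_map s" and ?l = "length s"
  have l: "1 \<le> ?l" "?l \<le> 2 * K + 1"
    using p by (auto simp: generic_paths_def is_path_def generating_sequence_def path_length_def)
  \<comment> \<open>The choice of a cell for the \<open>i\<close>-th step becomes membership in a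
    finite union.\<close>
  define dom where "dom k i = \<Union>{X \<in> Cs (k + i). s ! i \<in> Fs (k + i) X}" for k i
  define C where "C k x \<longleftrightarrow> (\<forall>i\<in>{..<?l}. ?h i x \<in> dom k i) \<and> ?h ?l x \<in> \<Union>(Cs (k + ?l))" for k x
  define E where "E x \<longleftrightarrow> (\<forall>i\<in>{..<?l}. (?h i x, ?h (Suc i) x) \<in> G) \<and>
      (\<forall>i\<in>{..?l}. \<forall>j\<in>{..?l}. ?h i x = ?h j x \<longrightarrow> i = j) \<and>
      ?h 0 x \<notin> covered N \<and> ?h ?l x \<notin> covered N \<and>
      (\<forall>i\<in>{..<?l}. (?h i x, ?h (Suc i) x) \<in> N \<or> (?h (Suc i) x, ?h i x) \<in> N \<longleftrightarrow> odd i)" for x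
  have T: "x \<in> ?T \<longleftrightarrow> (x \<in> A \<longrightarrow> C 0 x) \<and> (x \<notin> A \<longrightarrow> C 1 x) \<and> E x" for x
  proof -
    let ?p = "orbit ?h ?l x" and ?k = "start_index A (orbit ?h ?l x)"
    have "x \<in> ?T \<longleftrightarrow> (is_path G ?p \<and> augmenting_path G N ?p) \<and>
        (\<forall>i<Suc ?l. ?p ! i \<in> \<Union>(Cs (?k + i))) \<and> generating_sequence A Cs Fs ?p s"
      using l by (subst mem_starting_vertices) (auto simp: generic_paths_def is_path_def orbit_simps)
    also have "is_path G ?p \<and> augmenting_path G N ?p \<longleftrightarrow> E x"
    proof -
      have "distinct ?p \<longleftrightarrow> (\<forall>i\<in>{..?l}. \<forall>j\<in>{..?l}. ?h i x = ?h j x \<longrightarrow> i = j)"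
        unfolding distinct_conv_nth by (auto simp: orbit_simps less_Suc_eq_le)
      then show ?thesis
        using l by (auto simp: E_def is_path_def augmenting_path_def orbit_simps)
    qed
    also have "(\<forall>i<Suc ?l. ?p ! i \<in> \<Union>(Cs (?k + i))) \<and> generating_sequence A Cs Fs ?p s \<longleftrightarrow> C ?k x"
    proof -
      have "generating_sequence A Cs Fs ?p s \<longleftrightarrow> (\<forall>i\<in>{..<?l}. ?h i x \<in> dom ?k i)"
        by (auto simp: generating_sequence_def orbit_simps dom_def)
      moreover have "(\<forall>i<Suc ?l. ?p ! i \<in> \<Union>(Cs (?k + i))) \<longleftrightarrow>
          (\<forall>i\<in>{..<?l}. ?h i x \<in> \<Union>(Cs (?k + i))) \<and> ?h ?l x \<in> \<Union>(Cs (?k + ?l))"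
        by (auto simp: less_Suc_eq orbit_simps)
      moreover have "dom ?k i \<subseteq> \<Union>(Cs (?k + i))" for i
        unfolding dom_def by blast
      ultimately show ?thesis
        unfolding C_def by blast
    qed
    finally show ?thesis
      by (auto simp: start_index_def orbit_simps)
  qed
  have h: "definable_map R (?h i)" if "i \<le> ?l" for i
    using path_map_definable[OF pc p that] .
  have dom: "vdefinable R (dom k i)" if "k \<le> 1" "i < ?l" for k i
  proof -
    have ki: "k + i \<le> 2 * K + 2" using that l by simp
    show ?thesis
      unfolding dom_def
      using path_construction_maps[OF pc ki] path_construction_finite[OF pc ki]
      by (intro vdefinable_Union) auto
  qed
  have last: "vdefinable R (\<Union>(Cs (k + ?l)))" if "k \<le> 1" for k
  proof -
    \<comment> \<open>The last vertex lies at a stage between 1 and \<open>2 * K + 2\<close>, where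
      \<open>Cs\<close> is an open partition; the upper end is reached by a path of maximal length
      starting in \<open>B\<close>.\<close>
    have kl: "1 \<le> k + ?l" "k + ?l \<le> 2 * K + 2" using that l by simp_all
    then obtain X where "open_partition R X (Cs (k + ?l))"
      using path_construction_partition[OF pc] by blast
    then show ?thesis
      by (intro vdefinable_Union) (auto simp: open_partition_def vcell_vdefinable)
  qed
  have C: "vec_definable R (\<lambda>w. C k (w 0))" if "k \<le> 1" for k
    unfolding C_def using that l
    by (intro vec_definable_conj vec_definable_ball vec_definable_vimage dom last h) auto
  have E: "vec_definable R (\<lambda>w. E (w 0))"
    unfolding E_def
    by (intro vec_definable_conj vec_definable_ball vec_definable_imp vec_definable_iff
        vec_definable_disj vec_definable_not vec_definable_const vec_definable_vimage2[OF G]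
        vec_definable_vimage2[OF N] vec_definable_vimage[OF vdefinable_covered[OF N]]
        vec_definable_maps_eq h) auto
  have "vec_definable R (\<lambda>w. (w 0 \<in> A \<longrightarrow> C 0 (w 0)) \<and> (w 0 \<notin> A \<longrightarrow> C 1 (w 0)) \<and> E (w 0))"
    by (intro vec_definable_conj vec_definable_imp vec_definable_not vec_definable_mem[OF A] C E) auto
  then show ?thesis
    unfolding vdefinable_iff T .
qed

lemma vdefinable2_exchange:
  assumes "vdefinable R A" "vdefinable R B" "vdefinable2 R M" and D: "vdefinable R D"
    and h: "\<And>i. i \<le> l \<Longrightarrow> definable_map R (h i)" and l: "odd l"
  shows "vdefinable2 R (exchange A B h l D M)"
proof -
  define V where "V = (\<Union>i\<le>l. h i ` D)"
  have mate: "mate i \<le> l" if "i \<le> l" for i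
    using that l by (auto simp: mate_def Suc_le_eq order_less_le)
  have V: "vdefinable R V"
    unfolding V_def using D h by (intro vdefinable_Union) (auto intro: vdefinable_image)
  have "vec_definable R (\<lambda>w. \<exists>x. x \<in> D \<and> w 0 = h i x \<and> w 1 = h (mate i) x)" if "i \<le> l" for i
  proof -
    have "vec_definable R (\<lambda>w. w 2 \<in> D \<and> w 0 = h i (w 2) \<and> w 1 = h (mate i) (w 2))"
      using D h that mate by (intro vec_definable_conj vec_definable_mem vec_definable_eq_map) auto
    from vec_definable_ex[OF this, of 2] show ?thesis by simp
  qed
  then have "vec_definable R (\<lambda>w. ((w 0, w 1) \<in> M \<and> w 0 \<notin> V \<and> w 1 \<notin> V) \<or>
      (w 0 \<in> A \<and> w 1 \<in> B \<and> (\<exists>i\<in>{..l}. \<exists>x. x \<in> D \<and> w 0 = h i x \<and> w 1 = h (mate i) x)))"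
    using assms V by (intro vec_definable_disj vec_definable_conj vec_definable_not vec_definable_mem
        vec_definable_mem2 vec_definable_bex) auto
  then show ?thesis
    unfolding vdefinable2_iff exchange_def V_def[symmetric]
    by (rule back_subst[where P = "vec_definable R"]) (intro ext, simp add: Bex_def)
qed

section \<open>Measure\<close>

text \<open>Inner regularity yields a closed subset of the union with small complement; boundedness
  makes it compact, and a finite subcover does the rest.\<close>

lemma finite_subfamily_almost_covers:
  fixes \<Q> :: "'a::euclidean_space set set"
  assumes "\<And>Q. Q \<in> \<Q> \<Longrightarrow> open Q" "bounded (\<Union>\<Q>)" "0 < e"
  shows "\<exists>\<F>. finite \<F> \<and> \<F> \<subseteq> \<Q> \<and> emeasure lebesgue (\<Union>\<Q> - \<Union>\<F>) < ennreal e"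
proof -
  have "open (\<Union>\<Q>)" using assms by blast
  then have "\<Union>\<Q> \<in> sets lebesgue" using assms(2) lmeasurable_open by blast
  then obtain T where T: "closed T" "T \<subseteq> \<Union>\<Q>" "\<Union>\<Q> - T \<in> lmeasurable"
    "emeasure lebesgue (\<Union>\<Q> - T) < ennreal e"
    using sets_lebesgue_inner_closed assms(3) by blast
  then have "compact T"
    using assms(2) by (meson bounded_subset compact_eq_bounded_closed)
  then obtain \<F> where "\<F> \<subseteq> \<Q>" "finite \<F>" "T \<subseteq> \<Union>\<F>"
    using compactE[OF _ T(2)] assms(1) by metis
  moreover from this have "emeasure lebesgue (\<Union>\<Q> - \<Union>\<F>) \<le> emeasure lebesgue (\<Union>\<Q> - T)"
    using T(3) by (intro emeasure_mono) auto
  ultimately show ?thesis using T(4) by (meson order_le_less_trans)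
qed

text \<open>Superadditivity with one measurable summand: removing \<open>D\<close> from a measurable
  hull of \<open>F\<close> still leaves a set containing \<open>E\<close>.\<close>

lemma outer_measure_of_add_le:
  assumes "D \<in> sets M" "E \<inter> D = {}" "E \<union> D \<subseteq> F" "F \<subseteq> space M"
  shows "outer_measure_of M E + emeasure M D \<le> outer_measure_of M F"
proof -
  obtain B where B: "B \<in> sets M" "F \<subseteq> B" "outer_measure_of M F = emeasure M B"
    using outer_measure_of_attain[OF assms(4)] by blast
  have "outer_measure_of M E \<le> outer_measure_of M (B - D)"
    using assms B by (intro outer_measure_of_mono) auto
  also have "\<dots> = emeasure M (B - D)"
    using assms B by simp
  finally have "outer_measure_of M E + emeasure M D \<le> emeasure M (B - D) + emeasure M D"
    by (rule add_right_mono)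
  also have "\<dots> = emeasure M (B - D \<union> D)"
    using assms B by (intro plus_emeasure) auto
  also have "B - D \<union> D = B"
    using assms B by auto
  finally show ?thesis using B by simp
qed

text \<open>The finite bound \<open>c\<close> moves the supremum into the reals, where
  \<open>e\<close> can be subtracted from it.\<close>

lemma ennreal_almost_maximum:
  fixes f :: "'b \<Rightarrow> ennreal"
  assumes "X \<noteq> {}" "\<And>x. x \<in> X \<Longrightarrow> f x \<le> c" "c < \<infinity>" "0 < e"
  shows "\<exists>x\<in>X. \<forall>y\<in>X. f y < f x + ennreal e"
proof -
  define g where "g x = enn2real (f x)" for x
  have f: "f x = ennreal (g x)" if "x \<in> X" for x
    using assms(2)[OF that] assms(3) unfolding g_def by (metis ennreal_enn2real infinity_ennreal_def order_le_less_trans)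
  have bdd: "bdd_above (g ` X)"
    using assms(2,3) unfolding g_def by (intro bdd_aboveI2[of _ _ "enn2real c"] enn2real_mono) auto
  have "Sup (g ` X) - e < Sup (g ` X)" using assms(4) by simp
  then obtain x where x: "x \<in> X" "Sup (g ` X) - e < g x"
    using less_cSUP_iff[OF assms(1) bdd] by blast
  have "f y < f x + ennreal e" if "y \<in> X" for y
  proof -
    have "g y \<le> Sup (g ` X)" using that bdd by (rule cSUP_upper)
    then have "g y < g x + e" using x by linarith
    moreover have "0 \<le> g x" "0 \<le> g y" by (simp_all add: g_def)
    ultimately have "ennreal (g y) < ennreal (g x + e)" using assms(4) by (intro ennreal_lessI) auto
    then show ?thesis using f that x(1) \<open>0 \<le> g x\<close> assms(4) by (simp add: ennreal_plus)
  qed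
  then show ?thesis using x by blast
qed

text \<open>If \<open>T\<close> is not measurable, its \<open>emeasure\<close> is the junk value 0.  Together with the use of outer
  measure for the covered vertices, this makes it unnecessary to know that definable sets are
  measurable.\<close>

lemma emeasure_le_cover:
  fixes T :: "'a::euclidean_space set"
  assumes "T \<subseteq> S" "S \<in> sets lebesgue" "finite \<F>" "\<And>Q. Q \<in> \<F> \<Longrightarrow> open Q"
    and "emeasure lebesgue (S - \<Union>\<F>) < ennreal \<eta>" "real (card \<F>) * \<epsilon> \<le> \<eta>" "0 < \<eta>" "0 < \<epsilon>"
    and small: "\<And>Q. Q \<in> \<F> \<Longrightarrow> T \<in> sets lebesgue \<Longrightarrow> emeasure lebesgue (T \<inter> Q) \<le> ennreal \<epsilon>"
  shows "emeasure lebesgue T \<le> ennreal (2 * \<eta>)"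
proof (cases "T \<in> sets lebesgue")
  case False
  then show ?thesis by (simp add: emeasure_notin_sets)
next
  case True
  have open_sets: "Q \<in> sets lebesgue" if "Q \<in> \<F>" for Q
    using assms(4)[OF that] by auto
  have "open (\<Union>\<F>)"
    using assms(4) by blast
  then have union: "\<Union>\<F> \<in> sets lebesgue" by auto
  \<comment> \<open>The part of \<open>T\<close> outside the chosen sets costs at most
    \<open>\<eta>\<close>, and the pieces inside them together at most \<open>\<eta>\<close> again;
    hence the factor 2.\<close>
  have "emeasure lebesgue T \<le> emeasure lebesgue ((S - \<Union>\<F>) \<union> (\<Union>Q\<in>\<F>. T \<inter> Q))"
    using assms(1,2,3) True union by (intro emeasure_mono) (auto intro: sets.Int)
  also have "\<dots> \<le> emeasure lebesgue (S - \<Union>\<F>) + emeasure lebesgue (\<Union>Q\<in>\<F>. T \<inter> Q)"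
    using assms(2,3) True open_sets by (intro emeasure_subadditive) auto
  also have "emeasure lebesgue (\<Union>Q\<in>\<F>. T \<inter> Q) \<le> (\<Sum>Q\<in>\<F>. emeasure lebesgue (T \<inter> Q))"
    using assms(3) True open_sets by (intro emeasure_subadditive_finite) auto
  also have "\<dots> \<le> of_nat (card \<F>) * ennreal \<epsilon>"
    using small True by (intro sum_bounded_above) auto
  also have "\<dots> = ennreal (real (card \<F>) * \<epsilon>)"
    using assms(8) by (simp add: ennreal_mult ennreal_of_nat_eq_real_of_nat)
  also have "\<dots> \<le> ennreal \<eta>"
    using assms(6) by (rule ennreal_leI)
  also have "emeasure lebesgue (S - \<Union>\<F>) \<le> ennreal \<eta>"
    using assms(5) by simp
  finally show ?thesis using assms(7) by (simp add: add_mono ennreal_plus[symmetric] del: ennreal_plus)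
qed

section \<open>Exchange on one box and the near-maximal matching\<close>

text \<open>Combines the exchange with its definability. Augmenting paths start at uncovered
  vertices, so \<open>D\<close> is disjoint from what was covered, as needed for the measures to
  add.\<close>

lemma exchange_on_box:
  fixes Cs :: "nat \<Rightarrow> (real^'n::{finite,wellorder}) set set"
  assumes graph: "definable_bipartite_graph R A B G"
    and pc: "path_construction R A B G M K \<C> Cs Fs"
    and N: "vdefinable2 R N" "matching A B G N"
    and D: "D = starting_vertices A Cs Fs {p \<in> generic_paths A G K Cs. augmenting_path G N p} s \<inter> box a b"
    and inj: "\<And>x y i j. x \<in> box a b \<Longrightarrow> y \<in> box a b \<Longrightarrow> i \<le> length s \<Longrightarrow> j \<le> length s \<Longrightarrow>
      path_map s i x = path_map s j y \<Longrightarrow> i = j \<and> x = y"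
  shows "\<exists>N'. vdefinable2 R N' \<and> matching A B G N' \<and> covered N \<union> D \<subseteq> covered N' \<and> covered N \<inter> D = {}"
proof (cases "D = {}")
  case True
  \<comment> \<open>Nothing is to be flipped, and there is no path from which to read off the parity
    of \<open>length s\<close>; \<open>N\<close> itself serves.\<close>
  then show ?thesis using N by auto
next
  case False
  let ?T = "starting_vertices A Cs Fs {p \<in> generic_paths A G K Cs. augmenting_path G N p} s"
  have defs: "vdefinable R A" "vdefinable R B" "vdefinable2 R G"
    and AB: "A \<inter> B = {}" "G \<subseteq> A \<times> B \<union> B \<times> A" "sym G"
    using graph by (auto simp: definable_bipartite_graph_def)
  have orbit: "orbit (path_map s) (length s) x \<in> generic_paths A G K Cs"
    "augmenting_path G N (orbit (path_map s) (length s) x)"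
    "generating_sequence A Cs Fs (orbit (path_map s) (length s) x) s" if "x \<in> D" for x
  proof -
    have "x \<in> ?T" using that D by blast
    then show "orbit (path_map s) (length s) x \<in> generic_paths A G K Cs"
      "augmenting_path G N (orbit (path_map s) (length s) x)"
      "generating_sequence A Cs Fs (orbit (path_map s) (length s) x) s"
      by (simp_all add: mem_starting_vertices generic_paths_def is_path_def)
  qed
  have D_inj: "i = j \<and> x = y" if "x \<in> D" "y \<in> D" "i \<le> length s" "j \<le> length s"
    "path_map s i x = path_map s j y" for x y i j
    using inj[of x y i j] that D by blast
  obtain x where x: "x \<in> D" using False by blast
  have "vec_definable R (\<lambda>w. w 0 \<in> ?T \<and> w 0 \<in> box a b)"
    by (intro vec_definable_conj vec_definable_mem[OF vdefinable_augmenting_starts[OF pc defs(1,3) N(1)]]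
        vec_definable_box)
  then have "vdefinable R D"
    unfolding vdefinable_iff D by simp
  moreover have "odd (length s)"
    using augmenting_path_odd_length[OF orbit(2)[OF x]] by (simp add: orbit_simps)
  ultimately have "vdefinable2 R (exchange A B (path_map s) (length s) D N)"
    using defs N(1) path_map_definable[OF pc orbit(1)[OF x] orbit(3)[OF x]]
    by (intro vdefinable2_exchange) auto
  moreover have "matching A B G (exchange A B (path_map s) (length s) D N)"
    "covered N \<union> D \<subseteq> covered (exchange A B (path_map s) (length s) D N)"
    by (rule exchange_augments[OF AB N(2) path_map.simps(1) orbit(2) D_inj]; assumption)+
  moreover have "covered N \<inter> D = {}"
    using orbit(2) by (auto simp: augmenting_path_def orbit_simps)
  ultimately show ?thesis by blast
qed

theorem proposition2p6:
  fixes R :: "('f, 'r) expansion"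
    and A B :: "(real^'n::{finite,wellorder}) set"
    and G M :: "((real^'n::_) \<times> (real^'n::_)) set"
    and K :: nat
    and \<C> :: "((real^'n::_) \<times> (real^'n::_)) set set"
    and Cs :: "nat \<Rightarrow> (real^'n::_) set set"
    and Fs :: "nat \<Rightarrow> (real^'n::_) set \<Rightarrow> ((real^'n::_) \<Rightarrow> (real^'n::_)) set"
    and P :: "(real^'n::_) list set"
    and \<delta> :: real
  assumes "o_minimal R"
    and "definable_bipartite_graph R A B G"
    and "lambda_preserving R (A \<union> B) G"
    and "bounded A" and "bounded B"
    and "vdefinable2 R M" and "matching A B G M"
    and "path_construction R A B G M K \<C> Cs Fs"
    and "P = generic_paths A G K Cs"
    and "\<delta> > 0"
  shows "\<exists>M'. vdefinable2 R M' \<and> matching A B G M' \<and> covered M \<subseteq> covered M' \<and>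
    (\<exists>P'. P' \<subseteq> P \<and> definable_paths R A Cs Fs P' \<and>
       path_measure A Cs Fs P P' < ennreal \<delta> \<and>
       (\<forall>p\<in>P. path_length p \<le> 2 * K + 1 \<and> augmenting_path G M' p \<longrightarrow> p \<in> P'))"
proof -
  note pc = \<open>path_construction R A B G M K \<C> Cs Fs\<close>
  note graph = \<open>definable_bipartite_graph R A B G\<close>
  define \<Sigma> where "\<Sigma> = {s. \<exists>p\<in>P. generating_sequence A Cs Fs p s}"
  define Aug where "Aug N = {p \<in> generic_paths A G K Cs. augmenting_path G N p}" for N
  define T where "T N s = starting_vertices A Cs Fs (Aug N) s" for N s
  obtain r where r: "A \<union> B \<subseteq> ball 0 r"
    using \<open>bounded A\<close> \<open>bounded B\<close> bounded_subset_ballD[of "A \<union> B" 0] by auto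
  \<comment> \<open>The matching does not enter, so one family serves all matchings. The ball keeps
    the union bounded for the compactness argument.\<close>
  define \<Q> where "\<Q> s = {Q. \<exists>a b. Q = box a b \<and> Q \<subseteq> ball 0 r \<and> (\<forall>x\<in>Q. \<forall>y\<in>Q. \<forall>i\<le>length s. \<forall>j\<le>length s.
      path_map s i x = path_map s j y \<longrightarrow> i = j \<and> x = y)}"
    for s :: "((real^'n::_) \<Rightarrow> (real^'n::_)) list"
  have T_cover: "T N s \<subseteq> \<Union>(\<Q> s)" for N s
  proof
    fix x assume "x \<in> T N s"
    then obtain p where p: "p \<in> generic_paths A G K Cs" "generating_sequence A Cs Fs p s" "x = hd p"
      unfolding T_def Aug_def starting_vertices_def by blast
    have path: "is_path G p" using p(1) by (simp add: generic_paths_def)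
    then have "p \<noteq> []" "0 < path_length p" by (auto simp: is_path_def path_length_def)
    then have "(hd p, p ! Suc 0) \<in> G"
      using path by (simp add: is_path_def hd_conv_nth)
    then have "hd p \<in> A \<union> B"
      using graph unfolding definable_bipartite_graph_def by blast
    then have "hd p \<in> ball 0 r"
      using r by (rule subsetD[rotated])
    from path_map_locally_injective[OF pc p(1,2) open_ball this] p(3) show "x \<in> \<Union>(\<Q> s)"
      unfolding \<Q>_def by blast
  qed
  \<comment> \<open>Each generating sequence will cost at most \<open>2 * \<eta>\<close>. The added
    1 prevents division by zero and makes the total strictly less than
    \<open>\<delta>\<close>.\<close>
  define \<eta> where "\<eta> = \<delta> / (2 * (1 + real (card \<Sigma>)))"
  have \<eta>: "0 < \<eta>" using \<open>\<delta> > 0\<close> by (simp add: \<eta>_def)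
  have \<Q>_open: "open Q" if "Q \<in> \<Q> s" for Q s
    using that unfolding \<Q>_def by auto
  have \<Q>_bounded: "bounded (\<Union>(\<Q> s))" for s
    by (rule bounded_subset[OF bounded_ball[of 0 r]]) (auto simp: \<Q>_def)
  have "\<exists>\<F>. \<forall>s. finite (\<F> s) \<and> \<F> s \<subseteq> \<Q> s \<and>
      emeasure lebesgue (\<Union>(\<Q> s) - \<Union>(\<F> s)) < ennreal \<eta>"
    by (intro choice allI finite_subfamily_almost_covers[OF \<Q>_open \<Q>_bounded \<eta>])
  then obtain \<F> where \<F>: "\<And>s. finite (\<F> s)" "\<And>s. \<F> s \<subseteq> \<Q> s"
    "\<And>s. emeasure lebesgue (\<Union>(\<Q> s) - \<Union>(\<F> s)) < ennreal \<eta>"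
    by blast
  \<comment> \<open>Each box will cost at most \<open>\<epsilon>\<close>, and with this choice the
    boxes for any \<open>s\<close> in a finite \<open>\<Sigma>\<close> together cost at most
    \<open>\<eta>\<close>.\<close>
  define \<epsilon> where "\<epsilon> = \<eta> / (1 + real (\<Sum>s\<in>\<Sigma>. card (\<F> s)))"
  have \<epsilon>: "0 < \<epsilon>"
    unfolding \<epsilon>_def using \<eta> by (intro divide_pos_pos add_pos_nonneg of_nat_0_le_iff) auto
  define \<N> where "\<N> = {N. vdefinable2 R N \<and> matching A B G N \<and> covered M \<subseteq> covered N}"
  define \<Phi> where "\<Phi> N = outer_measure_of lebesgue (covered N)" for N :: "((real^'n::_) \<times> (real^'n::_)) set"
  have "M \<in> \<N>" using \<open>vdefinable2 R M\<close> \<open>matching A B G M\<close> by (simp add: \<N>_def)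
  have \<Phi>_le: "\<Phi> N \<le> emeasure lebesgue (ball 0 r :: (real^'n::_) set)" if "N \<in> \<N>" for N
  proof -
    have "covered N \<subseteq> ball 0 r"
      using covered_matching_subset[of A B G N] that r by (auto simp: \<N>_def)
    then have "\<Phi> N \<le> outer_measure_of lebesgue (ball 0 r :: (real^'n::_) set)"
      unfolding \<Phi>_def by (rule outer_measure_of_mono)
    then show ?thesis by simp
  qed
  have finite_ball: "emeasure lebesgue (ball 0 r :: (real^'n::_) set) < \<infinity>"
    using emeasure_bounded_finite[OF bounded_ball] by simp
  have "\<exists>N\<in>\<N>. \<forall>N'\<in>\<N>. \<Phi> N' < \<Phi> N + ennreal \<epsilon>"
    using \<open>M \<in> \<N>\<close> by (intro ennreal_almost_maximum[OF _ \<Phi>_le finite_ball \<epsilon>]) auto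
  then obtain N where N: "N \<in> \<N>" and max: "\<And>N'. N' \<in> \<N> \<Longrightarrow> \<Phi> N' < \<Phi> N + ennreal \<epsilon>"
    by blast
  have N': "vdefinable2 R N" "matching A B G N" "covered M \<subseteq> covered N"
    using N by (simp_all add: \<N>_def)
  have small: "emeasure lebesgue (T N s \<inter> Q) \<le> ennreal \<epsilon>"
    if Q: "Q \<in> \<Q> s" and meas: "T N s \<in> sets lebesgue" for s Q
  proof -
    obtain a b where ab: "Q = box a b" and inj: "\<forall>x\<in>Q. \<forall>y\<in>Q. \<forall>i\<le>length s. \<forall>j\<le>length s.
      path_map s i x = path_map s j y \<longrightarrow> i = j \<and> x = y"
      using Q unfolding \<Q>_def by blast
    obtain N1 where N1: "vdefinable2 R N1" "matching A B G N1"
      "covered N \<union> (T N s \<inter> Q) \<subseteq> covered N1" "covered N \<inter> (T N s \<inter> Q) = {}"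
      using exchange_on_box[OF graph pc N'(1,2), of "T N s \<inter> Q" s a b] inj
      unfolding T_def Aug_def ab by blast
    have "T N s \<inter> Q \<in> sets lebesgue"
      using meas ab by auto
    then have "\<Phi> N + emeasure lebesgue (T N s \<inter> Q) \<le> \<Phi> N1"
      unfolding \<Phi>_def using N1 by (intro outer_measure_of_add_le) auto
    also have "\<dots> < \<Phi> N + ennreal \<epsilon>"
      using N1 N'(3) by (intro max) (auto simp: \<N>_def)
    \<comment> \<open>The strict inequality forces \<open>\<Phi> N\<close> to be finite, so it
      cancels.\<close>
    finally show ?thesis
      using ennreal_add_left_cancel_less order_less_imp_le by blast
  qed
  have T_small: "emeasure lebesgue (T N s) \<le> ennreal (2 * \<eta>)" if "finite \<Sigma>" "s \<in> \<Sigma>" for s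
  proof (rule emeasure_le_cover[OF T_cover _ \<F>(1) _ \<F>(3) _ \<eta> \<epsilon>])
    show "\<Union>(\<Q> s) \<in> sets lebesgue"
      using \<Q>_open by (intro sets_completionI_sets) (auto intro: borel_open)
    have "card (\<F> s) \<le> (\<Sum>s\<in>\<Sigma>. card (\<F> s))"
      using that by (intro member_le_sum) auto
    then have "real (card (\<F> s)) \<le> 1 + real (\<Sum>s\<in>\<Sigma>. card (\<F> s))"
      by linarith
    then show "real (card (\<F> s)) * \<epsilon> \<le> \<eta>"
      using \<eta> unfolding \<epsilon>_def times_divide_eq_right
      by (subst pos_divide_le_eq) (auto simp: mult.commute intro: mult_right_mono simp del: of_nat_sum)
  qed (use \<Q>_open small \<F>(2) in blast)+
  have "path_measure A Cs Fs P (Aug N) < ennreal \<delta>"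
  proof (cases "finite \<Sigma>")
    case True
    have "path_measure A Cs Fs P (Aug N) = (\<Sum>s\<in>\<Sigma>. emeasure lebesgue (T N s))"
      unfolding path_measure_def \<Sigma>_def T_def ..
    also have "\<dots> \<le> of_nat (card \<Sigma>) * ennreal (2 * \<eta>)"
      using T_small[OF True] by (intro sum_bounded_above) auto
    also have "\<dots> = ennreal (real (card \<Sigma>) * (2 * \<eta>))"
      using \<eta> by (simp add: ennreal_mult ennreal_of_nat_eq_real_of_nat)
    also have "\<dots> < ennreal \<delta>"
    proof (rule ennreal_lessI[OF \<open>\<delta> > 0\<close>])
      show "real (card \<Sigma>) * (2 * \<eta>) < \<delta>"
        using \<open>\<delta> > 0\<close> by (simp add: \<eta>_def field_simps add_pos_nonneg)
    qed
    finally show ?thesis .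
  next
    \<comment> \<open>A sum over an infinite index set has the default value 0.\<close>
    case False
    then show ?thesis
      unfolding path_measure_def \<Sigma>_def[symmetric] using \<open>\<delta> > 0\<close> by simp
  qed
  moreover have "definable_paths R A Cs Fs (Aug N)"
    unfolding definable_paths_def Aug_def
    using vdefinable_augmenting_starts[OF pc _ _ N'(1)] graph by (simp add: definable_bipartite_graph_def)
  moreover have "Aug N \<subseteq> P" "\<forall>p\<in>P. path_length p \<le> 2 * K + 1 \<and> augmenting_path G N p \<longrightarrow> p \<in> Aug N"
    using \<open>P = generic_paths A G K Cs\<close> by (auto simp: Aug_def)
  ultimately show ?thesis using N' by blast
qed

end
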